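(* Let $\mathcal{M}$ and $\mathcal{N}$ be $AW^*$-factors of Type I. Then every spectral order isomorphism $\varphi:\mathcal{M}_{sa}\to\mathcal{N}_{sa}$ is canonical, i.e. there exist a strictly increasing bijection $f:\mathbb{R}\to\mathbb{R}$ and a projection isomorphism $\tau:P(\mathcal{M})\to P(\mathcal{N})$ such that $\varphi(x)=\Theta_\tau(f(x))$ for all $x\in\mathcal{M}_{sa}$.
   Context: An $AW^*$-algebra is a C*-algebra $\mathcal{M}$ such that for every nonempty $S\subseteq\mathcal{M}$ there is a projection $p$ with $\{x\in\mathcal{M}: sx=0\ \forall s\in S\}=p\mathcal{M}$; it is unital and its projections $P(\mathcal{M})$ form a complete lattice under the Löwner order $\le$. An $AW^*$-factor is an $AW^*$-algebra with one-dimensional center. $\mathcal{M}_{sa}$ denotes the self-adjoint part. Every $x\in\mathcal{M}_{sa}$ has a unique spectral family $(E^x_\lambda)_{\lambda\in\mathbb{R}}$ of projections: increasing, right-continuous ($E^x_\lambda=\bigwedge_{\mu>\lambda}E^x_\mu$), equal to $0$ for $\lambda<-\alpha$ and $\mathbf{1}$ for $\lambda>\alpha$ for some $\alpha>0$, with $xE^x_\lambda\le\lambda E^x_\lambda$ and $\lambda(\mathbf{1}-E^x_\lambda)\le x(\mathbf{1}-E^x_\lambda)$. The spectral order on $\mathcal{M}_{sa}$ is $x\preceq y$ iff $E^y_\lambda\le E^x_\lambda$ for all $\lambda$. A spectral order isomorphism is a bijection $\varphi$ with $x\preceq y\iff\varphi(x)\preceq\varphi(y)$. A projection isomorphism $\tau:P(\mathcal{M})\to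 P(\mathcal{N})$ is a bijection with $p\le q\iff\tau(p)\le\tau(q)$; it induces $\Theta_\tau:\mathcal{M}_{sa}\to\mathcal{N}_{sa}$ by $E^{\Theta_\tau(x)}_\lambda=\tau(E^x_\lambda)$ for all $\lambda$. $f(x)$ denotes continuous functional calculus. *)

theory Defs
  imports Complex_Main "HOL-Computational_Algebra.Polynomial"
begin

class cstar_algebra = real_normed_algebra_1 + banach +
  fixes scaleC :: "complex \<Rightarrow> 'a \<Rightarrow> 'a"
    and adj :: "'a \<Rightarrow> 'a"
  assumes scaleC_add_right: "scaleC c (x + y) = scaleC c x + scaleC c y"
    and scaleC_add_left: "scaleC (c + d) x = scaleC c x + scaleC d x"
    and scaleC_scaleC: "scaleC c (scaleC d x) = scaleC (c * d) x"
    and scaleC_one: "scaleC 1 x = x"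
    and scaleC_of_real: "scaleC (of_real r) x = scaleR r x"
    and scaleC_mult_left: "scaleC c x * y = scaleC c (x * y)"
    and scaleC_mult_right: "x * scaleC c y = scaleC c (x * y)"
    and norm_scaleC: "norm (scaleC c x) = cmod c * norm x"
    and adj_adj: "adj (adj x) = x"
    and adj_add: "adj (x + y) = adj x + adj y"
    and adj_mult: "adj (x * y) = adj y * adj x"
    and adj_scaleC: "adj (scaleC c x) = scaleC (cnj c) (adj x)"
    and cstar_identity: "norm (adj x * x) = norm x ^ 2"

definition sa_part :: "'a::cstar_algebra set" where
  "sa_part = {x. adj x = x}"

definition projections :: "'a::cstar_algebra set" where
  "projections = {p. adj p = p \<and> p * p = p}"

definition loewner :: "'a::cstar_algebra \<Rightarrow> 'a \<Rightarrow> bool" where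
  "loewner x y \<longleftrightarrow> (\<exists>a. y - x = adj a * a)"

definition center :: "'a::cstar_algebra set" where
  "center = {z. \<forall>x. z * x = x * z}"

definition AW_star :: "'a::cstar_algebra itself \<Rightarrow> bool" where
  "AW_star _ \<longleftrightarrow> (\<forall>S::'a set. S \<noteq> {} \<longrightarrow>
      (\<exists>p\<in>projections. {x. \<forall>s\<in>S. s * x = 0} = {p * y | y. True}))"

definition AW_factor :: "'a::cstar_algebra itself \<Rightarrow> bool" where
  "AW_factor T \<longleftrightarrow> AW_star T \<and> (center :: 'a set) = range (\<lambda>c. scaleC c 1)"

definition abelian_projection :: "'a::cstar_algebra \<Rightarrow> bool" where
  "abelian_projection p \<longleftrightarrow> p \<in> projections \<and>
     (\<forall>x y. (p * x * p) * (p * y * p) = (p * y * p) * (p * x * p))"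

text \<open>Type I (Kaplansky): there is a faithful abelian projection, i.e. an abelian
  projection whose central support is 1.\<close>
definition type_I :: "'a::cstar_algebra itself \<Rightarrow> bool" where
  "type_I _ \<longleftrightarrow> (\<exists>p::'a. abelian_projection p \<and>
      (\<forall>z\<in>projections \<inter> center. loewner p z \<longrightarrow> z = 1))"

definition proj_glb :: "'a::cstar_algebra set \<Rightarrow> 'a \<Rightarrow> bool" where
  "proj_glb A e \<longleftrightarrow> e \<in> projections \<and> (\<forall>a\<in>A. loewner e a) \<and>
      (\<forall>q\<in>projections. (\<forall>a\<in>A. loewner q a) \<longrightarrow> loewner q e)"

definition is_spectral_family :: "'a::cstar_algebra \<Rightarrow> (real \<Rightarrow> 'a) \<Rightarrow> bool" where
  "is_spectral_family x E \<longleftrightarrow>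
     (\<forall>l. E l \<in> projections) \<and>
     (\<forall>l m. l \<le> m \<longrightarrow> loewner (E l) (E m)) \<and>
     (\<forall>l. proj_glb {E m | m. m > l} (E l)) \<and>
     (\<exists>a>0. (\<forall>l< -a. E l = 0) \<and> (\<forall>l>a. E l = 1)) \<and>
     (\<forall>l. loewner (x * E l) (l *\<^sub>R E l)) \<and>
     (\<forall>l. loewner (l *\<^sub>R (1 - E l)) (x * (1 - E l)))"

definition spec :: "'a::cstar_algebra \<Rightarrow> real \<Rightarrow> 'a" where
  "spec x = (THE E. is_spectral_family x E)"

definition spectral_le :: "'a::cstar_algebra \<Rightarrow> 'a \<Rightarrow> bool" where
  "spectral_le x y \<longleftrightarrow> (\<forall>l. loewner (spec y l) (spec x l))"

definition spectral_order_iso :: "('a::cstar_algebra \<Rightarrow> 'b::cstar_algebra) \<Rightarrow> bool" where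
  "spectral_order_iso \<phi> \<longleftrightarrow> bij_betw \<phi> sa_part sa_part \<and>
     (\<forall>x\<in>sa_part. \<forall>y\<in>sa_part. spectral_le x y \<longleftrightarrow> spectral_le (\<phi> x) (\<phi> y))"

definition projection_iso :: "('a::cstar_algebra \<Rightarrow> 'b::cstar_algebra) \<Rightarrow> bool" where
  "projection_iso \<tau> \<longleftrightarrow> bij_betw \<tau> projections projections \<and>
     (\<forall>p\<in>projections. \<forall>q\<in>projections. loewner p q \<longleftrightarrow> loewner (\<tau> p) (\<tau> q))"

definition Theta :: "('a::cstar_algebra \<Rightarrow> 'b::cstar_algebra) \<Rightarrow> 'a \<Rightarrow> 'b" where
  "Theta \<tau> x = (THE y. y \<in> sa_part \<and> (\<forall>l. spec y l = \<tau> (spec x l)))"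

definition poly_eval :: "real poly \<Rightarrow> 'a::cstar_algebra \<Rightarrow> 'a" where
  "poly_eval p x = (\<Sum>i\<le>degree p. coeff p i *\<^sub>R x ^ i)"

text \<open>f(x) for self-adjoint x: the limit of p_n(x) for any sequence of real polynomials
  p_n converging uniformly to f on [-norm x, norm x] (which contains the spectrum).\<close>
definition fcalc :: "(real \<Rightarrow> real) \<Rightarrow> 'a::cstar_algebra \<Rightarrow> 'a" where
  "fcalc f x = (THE y. \<forall>P :: nat \<Rightarrow> real poly.
      (\<forall>e>0. eventually (\<lambda>n. \<forall>t\<in>{-norm x..norm x}. \<bar>poly (P n) t - f t\<bar> < e) sequentially)
      \<longrightarrow> (\<lambda>n. poly_eval (P n) x) \<longlonglongrightarrow> y)"

end

theory Submission
  imports Defs "HOL-Analysis.Weierstrass_Theorems"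
begin

text \<open>
  Spectral families turn the spectral order into an order on bounded right-continuous families of
  projections, and everything is read off from the \<^emph>\<open>steps\<close> \<open>a p + b (1 - p)\<close>, whose family takes
  the values \<open>0, p, 1\<close>. Scalars are the elements satisfying a distributivity law in the
  spectral order: the law forces each spectral projection to commute with all projections, hence to
  be \<open>0\<close> or \<open>1\<close> in a factor. So \<open>\<phi>\<close> maps scalars to scalars and defines \<open>f\<close>. In a type I
  factor the projection lattice is atomistic, and for a scalar \<open>a\<close> the order interval from \<open>a\<close>
  to \<open>x \<noteq> a\<close> is a chain exactly if \<open>x = a (1 - u) + b u\<close> with \<open>u\<close> an atom. Hence \<open>\<phi>\<close> maps such
  steps to such steps, with \<open>f\<close> acting on the end points and a bijection acting on the atoms.
  Atomisticity extends this to all steps, which yields \<open>\<tau>\<close>, and an arbitrary spectral family is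
  determined by the steps below it.

  The underlying theory of positivity rests on the binomial series for \<open>sqrt (1 - t)\<close>; spectral
  projections are annihilators of positive parts.
\<close>

text \<open>\<open>spec\<close>, \<open>Theta\<close> and \<open>fcalc\<close> are definite
  descriptions, so each is opaque until existence and uniqueness are proved. The spectrum is
  avoided: after the leading one, the coefficients of sqrt (1 - t) have total absolute value at most
  1, which turns positivity into the ball condition norm (t - x) \<le> t, visibly stable under sums
  and limits. That \<open>adj a * a\<close> is positive is then a theorem. On the order side the
  obstacle is that \<phi> need not respect sums, norms or continuity, so every transported notion is
  phrased by bounds alone. The image of a step first yields a projection that may depend on the end
  points. For atoms this dependence disappears because overlapping steps share their atom, for other
  projections because the coatoms above a projection determine it. Steps test a family only at
  strictly smaller arguments, so the last comparison needs right continuity. Every surjectivity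
  claim is the existence claim for the inverse isomorphism.\<close>

lemma adj_zero [simp]: "adj (0::'a::cstar_algebra) = 0"
  using adj_add[of "0::'a" 0] by simp

lemma adj_minus [simp]: "adj (- x) = - adj (x::'a::cstar_algebra)"
  using adj_add[of x "-x"] by (simp add: eq_neg_iff_add_eq_0 add.commute)

lemma adj_diff: "adj (x - y) = adj x - adj (y::'a::cstar_algebra)"
  using adj_add[of x "-y"] by simp

lemma adj_one [simp]: "adj (1::'a::cstar_algebra) = 1"
  by (metis adj_adj adj_mult mult.right_neutral mult.left_neutral)

lemma adj_scaleR: "adj (r *\<^sub>R x) = r *\<^sub>R adj (x::'a::cstar_algebra)"
  using adj_scaleC[of "of_real r" x] by (simp add: scaleC_of_real)

lemma adj_power: "adj (x ^ n) = adj (x::'a::cstar_algebra) ^ n"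
  by (induction n) (simp_all add: adj_mult power_commutes)

lemmas adj_simps = adj_adj adj_add adj_mult adj_diff adj_scaleR adj_power

text \<open>The C*-identity bounds the square of norm y by norm (adj y) times norm y; cancel norm y
  and use this for x and \<open>adj x\<close>.\<close>

lemma norm_adj [simp]: "norm (adj x) = norm (x::'a::cstar_algebra)"
proof -
  have le: "norm y \<le> norm (adj y)" for y :: 'a
  proof (cases "y = 0")
    case False
    have "norm y * norm y \<le> norm (adj y) * norm y"
      using norm_mult_ineq[of "adj y" y] by (simp add: cstar_identity power2_eq_square)
    then show ?thesis using False by simp
  qed simp
  show ?thesis using le[of x] le[of "adj x"] by (simp add: adj_adj)
qed

lemma adj_mult_self_eq_0_iff: "adj x * x = 0 \<longleftrightarrow> (x::'a::cstar_algebra) = 0"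
  by (metis cstar_identity mult_zero_right norm_eq_zero power_eq_0_iff zero_neq_numeral)

lemma bounded_linear_adj: "bounded_linear (adj :: 'a::cstar_algebra \<Rightarrow> 'a)"
  by (rule bounded_linear_intro[where K=1]) (simp_all add: adj_simps)

lemmas tendsto_adj = bounded_linear.tendsto[OF bounded_linear_adj]

lemma adj_fixed_limit:
  assumes "X \<longlonglongrightarrow> (x::'a::cstar_algebra)" "\<And>n. adj (X n) = X n"
  shows "adj x = x"
  using tendsto_adj[OF assms(1)] assms(1) LIMSEQ_unique by (simp add: assms(2)) blast

lemma norm_square_sa: "adj h = h \<Longrightarrow> norm (h * h) = (norm (h::'a::cstar_algebra))\<^sup>2"
  using cstar_identity[of h] by simp

lemma scaleC_imaginary: "scaleC \<i> (scaleC \<i> x) = - (x::'a::cstar_algebra)"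
  using scaleC_of_real[of "-1" x] by (simp add: scaleC_scaleC)

lemma scaleC_minus_left: "scaleC (- c) x = - scaleC c (x::'a::cstar_algebra)"
  using scaleC_add_left[of c "-c" x] scaleC_of_real[of 0 x]
  by (simp add: eq_neg_iff_add_eq_0 add.commute)

lemma scaleC_minus_right: "scaleC c (- x) = - scaleC c (x::'a::cstar_algebra)"
  using scaleC_mult_right[of "-1" c x] by simp

lemma scaleC_diff_right: "scaleC c (x - y) = scaleC c x - scaleC c (y::'a::cstar_algebra)"
  using scaleC_add_right[of c x "-y"] by (simp add: scaleC_minus_right)

text \<open>With u = h + i k, commutativity turns \<open>adj u * u\<close> into the sum of squares,
  and h is the real part of u. This stands in for monotonicity of the norm on positive elements
  before positivity is available.\<close>

lemma norm_le_of_commuting_squares: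
  fixes h k :: "'a::cstar_algebra"
  assumes "adj h = h" "adj k = k" "h * k = k * h" "norm (h * h + k * k) \<le> c\<^sup>2" "0 \<le> c"
  shows "norm h \<le> c"
proof -
  define u where "u = h + scaleC \<i> k"
  have au: "adj u = h - scaleC \<i> k"
    using assms by (simp add: u_def adj_simps adj_scaleC scaleC_minus_left)
  have "adj u * u = h * h + k * k"
    unfolding au by (simp add: u_def algebra_simps scaleC_mult_left scaleC_mult_right
        scaleC_imaginary scaleC_diff_right assms(3))
  then have "(norm u)\<^sup>2 \<le> c\<^sup>2" using cstar_identity[of u] assms(4) by simp
  then have nu: "norm u \<le> c" using assms(5) by (simp add: power2_le_iff_abs_le)
  have "2 *\<^sub>R h = u + adj u" unfolding au by (simp add: u_def scaleR_2)
  then have "2 * norm h \<le> norm u + norm (adj u)"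
    using norm_triangle_ineq[of u "adj u"] by (metis norm_scaleR abs_numeral)
  then show ?thesis using nu by simp
qed

lemma commuting_squares_sum_0:
  fixes h k :: "'a::cstar_algebra"
  assumes "adj h = h" "adj k = k" "h * k = k * h" "h * h + k * k = 0"
  shows "h = 0"
  using norm_le_of_commuting_squares[of h k 0] assms by simp

section \<open>Square roots by the binomial series\<close>

text \<open>The coefficient of t^n in the Taylor series of sqrt (1 - t).\<close>

definition sqrt_coeff :: "nat \<Rightarrow> real" where
  "sqrt_coeff n = (- 1) ^ n * ((1/2) gchoose n)"

lemma sqrt_coeff_0: "sqrt_coeff 0 = 1"
  by (simp add: sqrt_coeff_def)

lemma neg_half_gbinomial_nonneg: "0 \<le> (- 1) ^ n * ((- (1/2) :: real) gchoose n)"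
proof -
  have "pochhammer (1/2 :: real) n \<ge> 0"
    by (rule pochhammer_nonneg) simp
  then show ?thesis
    by (simp add: gbinomial_pochhammer flip: mult.assoc power_add) 
qed

text \<open>Absorption reduces this coefficient, up to a negative factor, to one of (1 - t) to the
  power -1/2, and those are nonnegative.\<close>

lemma sqrt_coeff_Suc_nonpos: "sqrt_coeff (Suc n) \<le> 0"
proof -
  have "real (Suc n) * ((1/2) gchoose Suc n) = (1/2) * ((1/2 - 1) gchoose n)"
    by (rule gbinomial_absorption)
  then have "real (Suc n) * sqrt_coeff (Suc n) = - (1/2) * ((- 1) ^ n * ((- (1/2)) gchoose n))"
    unfolding sqrt_coeff_def by (simp add: mult_ac del: of_nat_Suc)
  also have "\<dots> \<le> 0" using neg_half_gbinomial_nonneg[of n] by simp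
  finally show ?thesis by (simp add: mult_le_0_iff)
qed

text \<open>Taking partial sums multiplies the generating series by 1 / (1 - t), which turns sqrt (1
  - t) into its reciprocal.\<close>

lemma sqrt_coeff_partial_sum: "(\<Sum>k\<le>n. sqrt_coeff k) = (- 1) ^ n * ((- (1/2)) gchoose n)"
  using gbinomial_sum_lower_neg[of "1/2::real" n] by (simp add: sqrt_coeff_def mult.commute)

text \<open>The partial sums are nonnegative, so the nonpositive later coefficients cannot outweigh
  the leading 1. This gives convergence of the series up to norm 1 inclusive.\<close>

lemma sqrt_coeff_abs_partial_sum: "(\<Sum>k<n. \<bar>sqrt_coeff (Suc k)\<bar>) \<le> 1"
proof -
  have "(\<Sum>k<n. \<bar>sqrt_coeff (Suc k)\<bar>) = - (\<Sum>k<n. sqrt_coeff (Suc k))"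
    using sqrt_coeff_Suc_nonpos by (simp add: sum_negf[symmetric] abs_of_nonpos)
  also have "(\<Sum>k<n. sqrt_coeff (Suc k)) = (\<Sum>k\<le>n. sqrt_coeff k) - 1"
    using sum.lessThan_Suc_shift[of sqrt_coeff n]
    by (simp add: lessThan_Suc_atMost[symmetric] sqrt_coeff_0)
  finally show ?thesis
    using sqrt_coeff_partial_sum[of n] neg_half_gbinomial_nonneg[of n] by simp
qed

lemma summable_abs_sqrt_coeff_Suc: "summable (\<lambda>n. \<bar>sqrt_coeff (Suc n)\<bar>)"
  by (rule bounded_imp_summable[where B=1])
    (use sqrt_coeff_abs_partial_sum in \<open>auto simp only: abs_ge_zero simp flip: lessThan_Suc_atMost\<close>)

lemma suminf_abs_sqrt_coeff_Suc: "(\<Sum>n. \<bar>sqrt_coeff (Suc n)\<bar>) \<le> 1"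
  by (rule suminf_le_const[OF summable_abs_sqrt_coeff_Suc sqrt_coeff_abs_partial_sum])

definition csq :: "'a::cstar_algebra \<Rightarrow> 'a" where
  "csq t = (\<Sum>n. sqrt_coeff n *\<^sub>R t ^ n)"

context
  fixes t :: "'a::cstar_algebra"
  assumes t1: "norm t \<le> 1"
begin

lemma norm_csq_term: "norm (sqrt_coeff n *\<^sub>R t ^ n) \<le> \<bar>sqrt_coeff n\<bar>"
  using norm_power_ineq[of t n] power_le_one[of "norm t" n] t1
  by (simp add: mult_left_le)

lemma summable_norm_csq: "summable (\<lambda>n. norm (sqrt_coeff n *\<^sub>R t ^ n))"
  by (rule summable_comparison_test'[where g="\<lambda>n. \<bar>sqrt_coeff n\<bar>" and N=0])
    (use norm_csq_term summable_abs_sqrt_coeff_Suc summable_Suc_iff[of "\<lambda>n. \<bar>sqrt_coeff n\<bar>"] in auto)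

lemma csq_sums: "(\<lambda>n. sqrt_coeff n *\<^sub>R t ^ n) sums csq t"
  unfolding csq_def by (intro summable_sums summable_norm_cancel[OF summable_norm_csq])

text \<open>Vandermonde turns the Cauchy product of two series with exponent 1/2 into the series
  with exponent 1, which stops after the linear term.\<close>

lemma csq_square: "csq t * csq t = 1 - t"
proof -
  let ?a = "\<lambda>n. sqrt_coeff n *\<^sub>R t ^ n"
  have coeff: "(\<Sum>i\<le>k. ?a i * ?a (k - i)) = ((- 1) ^ k * ((1::real) gchoose k)) *\<^sub>R t ^ k" for k
  proof -
    have "(\<Sum>i\<le>k. ?a i * ?a (k - i)) = (\<Sum>i\<le>k. (sqrt_coeff i * sqrt_coeff (k - i)) *\<^sub>R t ^ k)"
      by (intro sum.cong) (auto simp flip: power_add)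
    also have "\<dots> = (\<Sum>i\<le>k. sqrt_coeff i * sqrt_coeff (k - i)) *\<^sub>R t ^ k"
      by (simp add: scaleR_left.sum)
    also have "(\<Sum>i\<le>k. sqrt_coeff i * sqrt_coeff (k - i)) =
        (\<Sum>i\<le>k. (- 1) ^ k * (((1/2) gchoose i) * ((1/2) gchoose (k - i))))"
      by (intro sum.cong) (auto simp: sqrt_coeff_def simp flip: power_add)
    also have "\<dots> = (- 1) ^ k * ((1::real) gchoose k)"
      using gbinomial_Vandermonde[of "1/2::real" "1/2" k]
      by (simp add: sum_distrib_left[symmetric] atLeast0AtMost)
    finally show ?thesis .
  qed
  have "(\<lambda>k. \<Sum>i\<le>k. ?a i * ?a (k - i)) sums (csq t * csq t)"
    using Cauchy_product_sums[OF summable_norm_csq summable_norm_csq] by (simp add: csq_def)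
  moreover have "(\<lambda>k. \<Sum>i\<le>k. ?a i * ?a (k - i)) sums
      (\<Sum>k\<in>{0,1}. ((- 1) ^ k * ((1::real) gchoose k)) *\<^sub>R t ^ k)"
    unfolding coeff
  proof (rule sums_finite)
    fix n :: nat assume "n \<notin> {0, 1}"
    then have "((1::real) gchoose n) = 0"
      using binomial_gbinomial[of 1 n, where ?'a=real] by (cases n) (auto simp: binomial_eq_0)
    then show "((- 1) ^ n * ((1::real) gchoose n)) *\<^sub>R t ^ n = 0" by simp
  qed simp
  ultimately show ?thesis using sums_unique2 by fastforce
qed

text \<open>The tail has total coefficient mass at most 1. By \<open>cpos_of_norm_bound\<close> this
  makes \<open>csq t\<close> positive for self-adjoint t.\<close>

lemma norm_one_minus_csq: "norm (1 - csq t) \<le> 1"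
proof -
  have "(\<lambda>n. sqrt_coeff (Suc n) *\<^sub>R t ^ Suc n) sums (csq t - 1)"
    using csq_sums by (subst sums_Suc_iff) (simp add: sqrt_coeff_0)
  then have eq: "csq t - 1 = (\<Sum>n. sqrt_coeff (Suc n) *\<^sub>R t ^ Suc n)" by (simp add: sums_iff)
  have "norm (\<Sum>n. sqrt_coeff (Suc n) *\<^sub>R t ^ Suc n) \<le> (\<Sum>n. \<bar>sqrt_coeff (Suc n)\<bar>)"
    by (rule norm_suminf_le[OF norm_csq_term summable_abs_sqrt_coeff_Suc])
  then show ?thesis using suminf_abs_sqrt_coeff_Suc
    by (simp add: norm_minus_commute[of 1] eq del: power_Suc)
qed

lemma adj_csq: "adj t = t \<Longrightarrow> adj (csq t) = csq t"
  using bounded_linear.sums[OF bounded_linear_adj csq_sums] csq_sums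
  by (simp add: adj_simps sums_unique2)

end

text \<open>For s = t this is commutation; different s and t occur in
  \<open>cpos_neg_adj_mult\<close>, where b intertwines the squares of two elements.\<close>

lemma csq_intertwine:
  fixes t :: "'a::cstar_algebra"
  assumes t1: "norm t \<le> 1" and bt: "b * t = s * b" and s1: "norm s \<le> 1"
  shows "b * csq t = csq s * b"
proof -
  have pow: "b * t ^ n = s ^ n * b" for n
    by (induction n) (simp_all add: mult.assoc, metis bt mult.assoc)
  from sums_mult2[OF csq_sums[OF s1], of b] sums_mult[OF csq_sums[OF t1], of b] show ?thesis
    by (simp add: pow sums_unique2)
qed

section \<open>The positive cone\<close>

text \<open>Squares of self-adjoint elements rather than elements \<open>adj a * a\<close>: square
  roots are then at hand from the start, and the agreement of the two notions is
  \<open>cpos_adj_mult\<close>.\<close>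

definition cpos :: "'a::cstar_algebra \<Rightarrow> bool" where
  "cpos x \<longleftrightarrow> (\<exists>h. adj h = h \<and> x = h * h)"

lemma cpos_adj: "cpos x \<Longrightarrow> adj x = x"
  by (auto simp: cpos_def adj_simps)

lemma cpos_square: "adj h = h \<Longrightarrow> cpos (h * h)"
  by (auto simp: cpos_def)

lemma cpos_projection: "p \<in> projections \<Longrightarrow> cpos p"
  by (auto simp: cpos_def projections_def intro: exI[of _ p])

lemma cpos_0 [simp]: "cpos 0"
  by (auto simp: cpos_def intro!: exI[of _ 0])

lemma cpos_scaleR:
  assumes "cpos x" "0 \<le> r" shows "cpos (r *\<^sub>R x)"
proof -
  obtain h where "adj h = h" "x = h * h" using assms cpos_def by blast
  then show ?thesis using assms(2)
    by (auto simp: cpos_def adj_simps intro!: exI[of _ "sqrt r *\<^sub>R h"])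
qed

text \<open>With k the square root of 1 - h^2, the squares of h and k sum to 1, so norm k is at most
  1 as well.\<close>

lemma norm_one_minus_square_le:
  fixes h :: "'a::cstar_algebra"
  assumes "adj h = h" "norm h \<le> 1" shows "norm (1 - h * h) \<le> 1"
proof -
  define k where "k = csq (h * h)"
  have n: "norm (h * h) \<le> 1" using assms by (simp add: norm_square_sa power_le_one)
  have k: "adj k = k" "k * k = 1 - h * h" "h * k = k * h"
    using adj_csq[OF n] csq_square[OF n] csq_intertwine[OF n _ n, of h] assms
    by (auto simp: k_def adj_simps mult.assoc)
  have "norm k \<le> 1"
    by (rule norm_le_of_commuting_squares[of k h]) (use k assms in auto)
  then show ?thesis using norm_square_sa[of k] k by (simp add: power_le_one)
qed

text \<open>The square root is a norm limit of polynomials in \<open>x\<close>, hence lies in the bicommutant.\<close>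

lemma square_root_of_norm_bound:
  fixes x :: "'a::cstar_algebra"
  assumes "adj x = x" "norm (t *\<^sub>R 1 - x) \<le> t"
  shows "\<exists>h. adj h = h \<and> x = h * h \<and> (\<forall>z. z * x = x * z \<longrightarrow> z * h = h * z)"
proof (cases "t > 0")
  case True
  define s where "s = 1 - (1 / t) *\<^sub>R x"
  have "s = (1 / t) *\<^sub>R (t *\<^sub>R 1 - x)" using True by (simp add: s_def algebra_simps)
  then have "norm s = norm (t *\<^sub>R 1 - x) / t" using True by simp
  then have s1: "norm s \<le> 1" using assms(2) True by simp
  have 1: "adj (csq s) = csq s" using assms(1) by (intro adj_csq s1) (simp add: s_def adj_simps)
  have 2: "csq s * csq s = (1 / t) *\<^sub>R x" unfolding csq_square[OF s1] by (simp add: s_def)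
  have 3: "z * csq s = csq s * z" if "z * x = x * z" for z
    by (rule csq_intertwine[OF s1 _ s1]) (simp add: s_def algebra_simps that)
  show ?thesis
  proof (intro exI conjI allI impI)
    show "adj (sqrt t *\<^sub>R csq s) = sqrt t *\<^sub>R csq s" by (simp add: adj_scaleR 1)
    show "x = (sqrt t *\<^sub>R csq s) * (sqrt t *\<^sub>R csq s)" using True by (simp add: 2)
    show "z * (sqrt t *\<^sub>R csq s) = (sqrt t *\<^sub>R csq s) * z" if "z * x = x * z" for z
      by (simp only: mult_scaleR_left mult_scaleR_right 3[OF that])
  qed
next
  case False
  then have "t = 0" using assms(2) norm_ge_zero[of "t *\<^sub>R 1 - x"] by linarith
  then have "x = 0" using assms(2) by simp
  then show ?thesis by (intro exI[of _ 0]) simp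
qed

lemma cpos_of_norm_bound: "adj x = x \<Longrightarrow> norm (t *\<^sub>R 1 - x) \<le> t \<Longrightarrow> cpos x"
  using square_root_of_norm_bound unfolding cpos_def by blast

text \<open>Rescaling by t reduces this to \<open>norm_one_minus_square_le\<close>. With
  \<open>cpos_of_norm_bound\<close> it describes positive elements by their distance to a multiple
  of 1.\<close>

lemma cpos_norm_bound:
  fixes x :: "'a::cstar_algebra"
  assumes "cpos x" "norm x \<le> t"
  shows "norm (t *\<^sub>R 1 - x) \<le> t"
proof (cases "t > 0")
  case True
  obtain h where h: "adj h = h" "x = h * h" using assms cpos_def by blast
  define g where "g = (1 / sqrt t) *\<^sub>R h"
  have "(norm h)\<^sup>2 \<le> (sqrt t)\<^sup>2" using assms h True by (simp add: norm_square_sa)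
  then have "norm h \<le> sqrt t" using True by (intro real_le_rsqrt) simp
  then have "norm g \<le> 1" using True by (simp add: g_def field_simps)
  moreover have "adj g = g" by (simp add: g_def adj_simps h)
  ultimately have "norm (1 - g * g) \<le> 1" using norm_one_minus_square_le by blast
  moreover have "t *\<^sub>R 1 - x = t *\<^sub>R (1 - g * g)"
    using True by (simp add: g_def h algebra_simps)
  ultimately show ?thesis using True by (simp add: mult_left_le)
next
  case False
  then have "t = 0" using assms(2) norm_ge_zero[of x] by linarith
  then show ?thesis using assms by simp
qed

lemma cpos_square_root:
  assumes "cpos x"
  obtains h where "adj h = h" "x = h * h" "\<And>z. z * x = x * z \<Longrightarrow> z * h = h * z"
  using square_root_of_norm_bound[OF cpos_adj[OF assms] cpos_norm_bound[OF assms order_refl]] by blast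

lemma cpos_add:
  assumes "cpos x" "cpos y" shows "cpos (x + y)"
proof (rule cpos_of_norm_bound)
  show "adj (x + y) = x + y" using assms by (simp add: adj_simps cpos_adj)
  have "norm ((norm x *\<^sub>R 1 - x) + (norm y *\<^sub>R 1 - y)) \<le> norm x + norm y"
    using cpos_norm_bound[OF assms(1) order_refl] cpos_norm_bound[OF assms(2) order_refl]
    by (intro order_trans[OF norm_triangle_ineq]) simp
  then show "norm ((norm x + norm y) *\<^sub>R 1 - (x + y)) \<le> norm x + norm y"
    by (simp add: algebra_simps)
qed

text \<open>The roots of x and - x commute because each lies in a bicommutant, and their squares sum
  to 0.\<close>

lemma cpos_antisym:
  assumes "cpos x" "cpos (- x)" shows "x = 0"
proof -
  obtain h where h: "adj h = h" "x = h * h" "\<And>z. z * x = x * z \<Longrightarrow> z * h = h * z"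
    using cpos_square_root[OF assms(1)] by blast
  obtain k where k: "adj k = k" "- x = k * k" "\<And>z. z * (- x) = (- x) * z \<Longrightarrow> z * k = k * z"
    using cpos_square_root[OF assms(2)] by blast
  have "h * k = k * h" by (rule k(3)) (simp add: h(2) mult.assoc)
  then have "h = 0" using commuting_squares_sum_0[of h k] h k by (metis add.right_inverse)
  then show ?thesis using h(2) by simp
qed

lemma cpos_norm_minus: "adj x = x \<Longrightarrow> cpos (norm x *\<^sub>R 1 - x)"
  by (rule cpos_of_norm_bound[where t="norm x"]) (simp_all add: adj_simps)

lemma cpos_norm_plus: "adj x = x \<Longrightarrow> cpos (norm x *\<^sub>R 1 + x)"
  using cpos_norm_minus[of "- x"] by simp

text \<open>Roots taken in the bicommutants commute, so h k is self-adjoint with square x y.\<close>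

lemma cpos_mult:
  assumes "cpos x" "cpos y" "x * y = y * x" shows "cpos (x * y)"
proof -
  obtain h where h: "adj h = h" "x = h * h" "\<And>z. z * x = x * z \<Longrightarrow> z * h = h * z"
    using cpos_square_root[OF assms(1)] by blast
  obtain k where k: "adj k = k" "y = k * k" "\<And>z. z * y = y * z \<Longrightarrow> z * k = k * z"
    using cpos_square_root[OF assms(2)] by blast
  have "x * k = k * x" by (rule k(3)) (rule assms(3))
  then have hk: "k * h = h * k" by (intro h(3)) simp
  have "x * y = (h * k) * (h * k)" unfolding h(2) k(2) by (metis hk mult.assoc)
  moreover have "adj (h * k) = h * k" using hk h(1) k(1) by (simp add: adj_mult)
  ultimately show ?thesis by (simp only: cpos_square)
qed

lemma norm_le_of_cpos:
  assumes "cpos x" "cpos (t *\<^sub>R 1 - x)" "0 \<le> t" shows "norm x \<le> t"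
proof -
  obtain h where h: "adj h = h" "x = h * h" "\<And>z. z * x = x * z \<Longrightarrow> z * h = h * z"
    using cpos_square_root[OF assms(1)] by blast
  obtain k where k: "adj k = k" "t *\<^sub>R 1 - x = k * k"
      "\<And>z. z * (t *\<^sub>R 1 - x) = (t *\<^sub>R 1 - x) * z \<Longrightarrow> z * k = k * z"
    using cpos_square_root[OF assms(2)] by blast
  have hk: "h * k = k * h" by (rule k(3)) (simp add: h(2) algebra_simps)
  have "h * h + k * k = t *\<^sub>R 1" unfolding h(2)[symmetric] k(2)[symmetric] by simp
  then have "norm h \<le> sqrt t"
    using norm_le_of_commuting_squares[OF h(1) k(1) hk, of "sqrt t"] assms(3) by simp
  then have "(norm h)\<^sup>2 \<le> t" using assms(3) by (metis norm_ge_zero power_mono real_sqrt_pow2)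
  then show ?thesis using h(1,2) by (simp add: norm_square_sa)
qed

text \<open>The product of t - x and t + x is positive and bounds x^2 by t^2.\<close>

lemma norm_le_of_cpos_both:
  assumes "cpos (t *\<^sub>R 1 - x)" "cpos (t *\<^sub>R 1 + x)" "0 \<le> t" shows "norm x \<le> t"
proof -
  have "adj (t *\<^sub>R 1 - x) = t *\<^sub>R 1 - x" using assms cpos_adj by blast
  then have sa: "adj x = x" by (simp add: adj_simps)
  have "cpos ((t *\<^sub>R 1 - x) * (t *\<^sub>R 1 + x))"
    by (rule cpos_mult) (use assms in \<open>auto simp: algebra_simps\<close>)
  then have "cpos ((t\<^sup>2) *\<^sub>R 1 - x * x)" by (simp add: algebra_simps power2_eq_square)
  then have "norm (x * x) \<le> t\<^sup>2" using norm_le_of_cpos[OF cpos_square[OF sa]] by simp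
  then show ?thesis using sa assms(3) by (simp add: norm_square_sa power2_le_iff_abs_le)
qed

text \<open>A convergent sequence is bounded, so a single t serves all members in the ball
  condition, which is closed.\<close>

lemma cpos_limit:
  assumes "X \<longlonglongrightarrow> x" "\<And>n. cpos (X n)" shows "cpos x"
proof -
  obtain t where t: "\<And>n. norm (X n) \<le> t"
    using convergent_imp_Bseq[OF convergentI[OF assms(1)]] unfolding Bseq_def by blast
  have "(\<lambda>n. norm (t *\<^sub>R 1 - X n)) \<longlonglongrightarrow> norm (t *\<^sub>R 1 - x)"
    by (intro tendsto_intros assms)
  then have "norm (t *\<^sub>R 1 - x) \<le> t"
    by (rule LIMSEQ_le_const2) (use cpos_norm_bound[OF assms(2) t] in auto)
  moreover have "adj x = x" using adj_fixed_limit[OF assms(1)] cpos_adj[OF assms(2)] by blast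
  ultimately show ?thesis using cpos_of_norm_bound by blast
qed

lemma cpos_of_eps:
  assumes "\<And>e. 0 < e \<Longrightarrow> cpos (x + e *\<^sub>R y)" shows "cpos x"
proof (rule cpos_limit)
  have "(\<lambda>n. x + inverse (real (Suc n)) *\<^sub>R y) \<longlonglongrightarrow> x + 0 *\<^sub>R y"
    by (intro tendsto_intros LIMSEQ_inverse_real_of_nat)
  then show "(\<lambda>n. x + inverse (real (Suc n)) *\<^sub>R y) \<longlonglongrightarrow> x" by simp
qed (use assms in simp)

text \<open>For y = s - d one has y^2 (s + d) = 0. Both summands are positive, hence vanish, and
  their difference is y^3.\<close>

lemma cpos_square_root_unique:
  assumes "cpos d" "cpos s" "s * s = d * d" "s * d = d * s"
  shows "s = d"
proof -
  define y where "y = s - d"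
  have ya: "adj y = y" using assms by (simp add: y_def adj_simps cpos_adj)
  have yy: "y * y * d + y * y * s = 0"
  proof -
    have "y * y * d + y * y * s = y * (y * (s + d))" by (simp add: algebra_simps)
    also have "y * (s + d) = 0" using assms(3,4) by (simp add: y_def algebra_simps)
    finally show ?thesis by simp
  qed
  have "y * d = d * y" "y * s = s * y" using assms(4)
    by (simp_all add: y_def left_diff_distrib right_diff_distrib)
  then have "y * y * d = d * (y * y)" "y * y * s = s * (y * y)" by (metis mult.assoc)+
  then have c1: "cpos (y * y * d)" and c2: "cpos (y * y * s)"
    by (intro cpos_mult cpos_square ya assms; simp)+
  have "y * y * s = - (y * y * d)" using yy by (simp add: add_eq_0_iff)
  then have z: "y * y * d = 0" using cpos_antisym[OF c1] c2 by simp
  then have "y * y * s = 0" using yy by simp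
  then have "y * y * y = 0" using z by (simp add: y_def algebra_simps)
  then have "(y * y) * (y * y) = 0" by (metis mult.assoc mult_zero_right mult_zero_left)
  then have "norm (y * y) = 0" using norm_square_sa[of "y * y"] ya by (simp add: adj_simps)
  then have "y = 0" using norm_square_sa[OF ya] by simp
  then show ?thesis by (simp add: y_def)
qed

section \<open>AW*-algebras\<close>

lemma projectionsD: "p \<in> projections \<Longrightarrow> adj p = p" "p \<in> projections \<Longrightarrow> p * p = p"
  by (auto simp: projections_def)

lemma projection_0 [simp]: "0 \<in> projections" and projection_1 [simp]: "1 \<in> projections"
  by (auto simp: projections_def)

lemma projection_compl: "p \<in> projections \<Longrightarrow> 1 - p \<in> projections"
  by (auto simp: projections_def adj_simps algebra_simps)

lemma projection_mult: "p \<in> projections \<Longrightarrow> q \<in> projections \<Longrightarrow> p * q = q * p \<Longrightarrow> p * q \<in> projections"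
  by (auto simp: projections_def adj_simps) (metis mult.assoc)

lemma commutes_adj: "z * s = s * z \<Longrightarrow> adj s = s \<Longrightarrow> adj z * s = s * adj (z::'a::cstar_algebra)"
  by (metis adj_mult)

lemma commute_intros:
  fixes a b c :: "'a::real_algebra_1"
  shows "a * c = c * a \<Longrightarrow> b * c = c * b \<Longrightarrow> (a - b) * c = c * (a - b)"
    "c * a = a * c \<Longrightarrow> c * b = b * c \<Longrightarrow> c * (a - b) = (a - b) * c"
    "a * c = c * a \<Longrightarrow> b * c = c * b \<Longrightarrow> (a * b) * c = c * (a * b)"
    "c * a = a * c \<Longrightarrow> c * b = b * c \<Longrightarrow> c * (a * b) = (a * b) * c"
    "a * c = c * a \<Longrightarrow> (r *\<^sub>R a) * c = c * (r *\<^sub>R a)"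
    "c * a = a * c \<Longrightarrow> c * (r *\<^sub>R a) = (r *\<^sub>R a) * c"
    "1 * c = c * 1" "c * 1 = 1 * c"
  by (simp_all add: left_diff_distrib right_diff_distrib) (metis mult.assoc)+

locale aw_star_algebra =
  fixes T :: "'a::cstar_algebra itself"
  assumes AW: "AW_star T"
begin

lemma annihilator:
  assumes "S \<noteq> {}"
  obtains p :: 'a where "p \<in> projections" "\<And>x. (\<forall>s\<in>S. s * x = 0) \<longleftrightarrow> p * x = x"
proof -
  obtain p where p: "p \<in> projections" "{x. \<forall>s\<in>S. s * x = 0} = {p * y | y. True}"
    using AW[unfolded AW_star_def, rule_format, OF assms] by blast
  have "(\<forall>s\<in>S. s * x = 0) \<longleftrightarrow> p * x = x" for x
  proof -
    have "(\<forall>s\<in>S. s * x = 0) \<longleftrightarrow> (\<exists>y. x = p * y)" using p(2) by blast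
    also have "\<dots> \<longleftrightarrow> p * x = x" by (metis mult.assoc p(1) projectionsD(2))
    finally show ?thesis .
  qed
  then show thesis using that p by blast
qed

text \<open>The commutant of S maps the right annihilator of S into itself. Using this for z and for
  \<open>adj z\<close> gives z p = p z, so p lies in the bicommutant of S.\<close>

lemma sa_annihilator:
  assumes "S \<noteq> {}" "\<And>s. s \<in> S \<Longrightarrow> adj s = s"
  obtains p :: 'a where "p \<in> projections" "\<And>x. (\<forall>s\<in>S. s * x = 0) \<longleftrightarrow> p * x = x"
    "\<And>z. (\<And>s. s \<in> S \<Longrightarrow> z * s = s * z) \<Longrightarrow> z * p = p * z"
proof -
  obtain p where p: "p \<in> projections" "\<And>x. (\<forall>s\<in>S. s * x = 0) \<longleftrightarrow> p * x = x"
    using annihilator[OF assms(1)] by blast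
  have *: "p * (z * p) = z * p" if "\<And>s. s \<in> S \<Longrightarrow> z * s = s * z" for z
  proof -
    have "\<forall>s\<in>S. s * p = 0" using p projectionsD(2)[OF p(1)] by blast
    then have "\<forall>s\<in>S. s * (z * p) = 0" by (metis mult.assoc mult_zero_right that)
    then show ?thesis using p(2) by blast
  qed
  have "z * p = p * z" if z: "\<And>s. s \<in> S \<Longrightarrow> z * s = s * z" for z
  proof -
    have "p * (adj z * p) = adj z * p" by (rule *) (use commutes_adj z assms(2) in blast)
    then have "adj (p * (adj z * p)) = adj (adj z * p)" by simp
    then have "(p * z) * p = p * z" by (simp add: adj_mult adj_adj projectionsD(1)[OF p(1)])
    then show ?thesis using *[OF z] by (simp add: mult.assoc)
  qed
  then show thesis using that p by blast
qed

text \<open>The projection \<open>e\<close> is the right annihilator of the positive part \<open>(\<bar>x\<bar> + x)/2\<close>.\<close>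

lemma negative_part_projection_aux:
  fixes x :: 'a
  assumes x: "adj x = x" and n: "norm x \<le> 1"
  shows "\<exists>e\<in>projections. (\<forall>z. z * x = x * z \<longrightarrow> z * e = e * z) \<and> cpos (- (x * e)) \<and>
    cpos (x * (1 - e)) \<and> (\<forall>r. x * (1 - e) * r = 0 \<longrightarrow> e * r = r)"
proof -
  have n1: "norm (1 - x * x) \<le> 1" using norm_one_minus_square_le[OF x n] .
  \<comment> \<open>\<open>a\<close> is the absolute value of x, the positive root of x^2.\<close>
  define a where "a = csq (1 - x * x)"
  have a: "adj a = a" "a * a = x * x" "norm (1 - a) \<le> 1"
    using adj_csq[OF n1] csq_square[OF n1] norm_one_minus_csq[OF n1] x
    by (auto simp: a_def adj_simps)
  have ac: "z * a = a * z" if "z * x = x * z" for z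
  proof -
    have "z * (1 - x * x) = (1 - x * x) * z"
      using that by (simp add: algebra_simps) (metis mult.assoc)
    then show ?thesis unfolding a_def by (rule csq_intertwine[OF n1 _ n1])
  qed
  have xa: "x * a = a * x" by (rule ac) simp
  have pa: "cpos a" using cpos_of_norm_bound[OF a(1), of 1] a(3) by simp
  have say: "adj (a + x) = a + x" using a x by (simp add: adj_simps)
  obtain e where e: "e \<in> projections" "\<And>r. (\<forall>s\<in>{a + x}. s * r = 0) \<longleftrightarrow> e * r = r"
      "\<And>z. (\<And>s. s \<in> {a + x} \<Longrightarrow> z * s = s * z) \<Longrightarrow> z * e = e * z"
    using sa_annihilator[of "{a + x}"] say by blast
  have er: "(a + x) * r = 0 \<longleftrightarrow> e * r = r" for r using e(2) by simp
  have ec: "z * e = e * z" if "z * x = x * z" for z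
    by (rule e(3)) (use that ac[OF that] in \<open>simp add: algebra_simps\<close>)
  have xe: "x * e = e * x" and ae: "a * e = e * a" using ec[of x] ec[of a] xa by auto
  have ye: "(a + x) * e = 0" using er projectionsD(2)[OF e(1)] by blast
  then have 1: "- (x * e) = a * e" by (simp add: algebra_simps add_eq_0_iff)
  \<comment> \<open>The positive part annihilates the negative part, so \<open>e\<close> fixes the
    latter.\<close>
  have "(a + x) * (a - x) = 0" using a(2) xa by (simp add: algebra_simps)
  then have "e * (a - x) = a - x" using er by blast
  then have 2: "a * (1 - e) = x * (1 - e)" using xe ae by (simp add: algebra_simps)
  have p1: "cpos (- (x * e))" unfolding 1 by (intro cpos_mult pa cpos_projection e ae)
  have p2: "cpos (x * (1 - e))" unfolding 2[symmetric]
    by (intro cpos_mult pa cpos_projection projection_compl e) (simp add: algebra_simps ae)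
  have "e * r = r" if "x * (1 - e) * r = 0" for r
  proof -
    have "(a + x) * r = (a + x) * e * r + a * (1 - e) * r + x * (1 - e) * r"
      by (simp add: algebra_simps)
    also have "\<dots> = 0" unfolding ye 2 that by simp
    finally show ?thesis using er by blast
  qed
  then show ?thesis using e(1) ec p1 p2 by blast
qed

text \<open>Rescaling to the unit ball, with \<open>+ 1\<close> to keep the factor positive for x =
  0. The last conjunct says that e absorbs the kernel of x, which makes the spectral family right
  continuous.\<close>

lemma negative_part_projection:
  fixes x :: 'a
  assumes x: "adj x = x"
  shows "\<exists>e\<in>projections. (\<forall>z. z * x = x * z \<longrightarrow> z * e = e * z) \<and> cpos (- (x * e)) \<and>
    cpos (x * (1 - e)) \<and> (\<forall>r. x * (1 - e) * r = 0 \<longrightarrow> e * r = r)"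
proof -
  define c where "c = norm x + 1"
  have c: "c > 0" by (simp add: c_def add_nonneg_pos)
  define y where "y = (1 / c) *\<^sub>R x"
  have xy: "x = c *\<^sub>R y" using c by (simp add: y_def)
  have "norm y \<le> 1" using c by (simp add: y_def c_def)
  moreover have "adj y = y" by (simp add: y_def adj_simps x)
  ultimately obtain e where e: "e \<in> projections" "\<And>z. z * y = y * z \<Longrightarrow> z * e = e * z"
      "cpos (- (y * e))" "cpos (y * (1 - e))" "\<And>r. y * (1 - e) * r = 0 \<Longrightarrow> e * r = r"
    using negative_part_projection_aux by blast
  show ?thesis
    using e(1,2,5) cpos_scaleR[OF e(3), of c] cpos_scaleR[OF e(4), of c] c
    by (intro bexI[of _ e]) (auto simp: xy)
qed

text \<open>With \<open>c = b b\<^sup>*\<close> and \<open>d = - b\<^sup>* b\<close>, both positive, \<open>b d = - c b\<close> gives \<open>b d\<^sup>2 = c\<^sup>2 b\<close>; passing to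
  square roots, \<open>b d = c b\<close>, so \<open>c b = 0\<close>.\<close>

lemma cpos_neg_adj_mult:
  fixes b :: 'a
  assumes "cpos (- (adj b * b))" shows "b = 0"
proof -
  have aux: "b = 0" if p: "cpos (- (adj b * b))" and n: "norm b \<le> 1" for b :: 'a
  proof -
    define c where "c = b * adj b"
    define d where "d = - (adj b * b)"
    \<comment> \<open>Up to sign, k and \<open>b + adj b\<close> are twice the imaginary and real
      parts of b; half the sum of their squares is \<open>adj b * b + b * adj b\<close>.\<close>
    define k where "k = scaleC \<i> (b - adj b)"
    have k: "adj k = k"
      by (simp add: k_def adj_scaleC adj_simps scaleC_minus_left scaleC_diff_right)
    have kk: "k * k = - ((b - adj b) * (b - adj b))"
      by (simp add: k_def scaleC_mult_left scaleC_mult_right scaleC_imaginary)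
    have "c = (1/2) *\<^sub>R ((b + adj b) * (b + adj b) + k * k) + d"
      unfolding kk by (simp add: c_def d_def algebra_simps flip: scaleR_add_left)
    moreover have "cpos d" using p by (simp add: d_def)
    moreover have "adj (b + adj b) = b + adj b" by (simp add: adj_simps add.commute)
    ultimately have pc: "cpos c" by (simp add: cpos_add cpos_scaleR cpos_square k)
    have nc: "norm c \<le> 1" "norm d \<le> 1"
      using n cstar_identity[of b] cstar_identity[of "adj b"]
      by (simp_all add: c_def d_def adj_adj power_le_one)
    \<comment> \<open>The series gives some positive root of y^2; uniqueness identifies it with y,
      so intertwining passes from the squares to d and c themselves.\<close>
    have root: "csq (1 - y * y) = y" if y: "cpos y" "norm y \<le> 1" for y :: 'a
    proof -
      have n1: "norm (1 - y * y) \<le> 1" by (rule norm_one_minus_square_le) (use y cpos_adj in auto)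
      have "cpos (csq (1 - y * y))"
        using norm_one_minus_csq[OF n1] adj_csq[OF n1] y
        by (intro cpos_of_norm_bound[where t=1]) (auto simp: adj_simps cpos_adj)
      moreover have "csq (1 - y * y) * csq (1 - y * y) = y * y" using csq_square[OF n1] by simp
      moreover have "csq (1 - y * y) * y = y * csq (1 - y * y)"
        using csq_intertwine[OF n1 _ n1, of y] by (simp add: algebra_simps)
      ultimately show ?thesis using cpos_square_root_unique y(1) by blast
    qed
    have bd: "b * d = - (c * b)" by (simp add: c_def d_def mult.assoc)
    have "b * (d * d) = (b * d) * d" by (simp add: mult.assoc)
    also have "\<dots> = - (c * (b * d))" by (simp add: bd mult.assoc)
    also have "\<dots> = c * c * b" by (simp add: bd mult.assoc)
    finally have "b * (d * d) = c * c * b" .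
    then have "b * (1 - d * d) = (1 - c * c) * b" by (simp add: algebra_simps)
    then have "b * csq (1 - d * d) = csq (1 - c * c) * b"
      by (rule csq_intertwine[rotated])
        (use norm_one_minus_square_le nc \<open>cpos d\<close> pc cpos_adj in auto)
    then have "b * d = c * b" using root nc \<open>cpos d\<close> pc by simp
    then have "c * b = - (c * b)" using bd by simp
    then have "c * b + c * b = 0" by (metis add.right_inverse)
    then have "c * b = 0" by (simp flip: scaleR_2)
    \<comment> \<open>Cancellation by the C*-identity is used twice: first \<open>adj b * b\<close>
      vanishes, then b.\<close>
    then have "adj (adj b * b) * (adj b * b) = 0" by (simp add: c_def adj_simps mult.assoc)
    then show ?thesis using adj_mult_self_eq_0_iff by blast
  qed
  show ?thesis
  proof (cases "b = 0")
    case False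
    have "(1 / norm b) *\<^sub>R b = 0"
      using cpos_scaleR[OF assms, of "1 / (norm b)\<^sup>2"] False
      by (intro aux) (simp_all add: adj_simps power2_eq_square)
    then show ?thesis using False by simp
  qed
qed

text \<open>Cutting x = \<open>adj a * a\<close> by its negative part projection e gives
  \<open>adj (a * e) * (a * e)\<close> = x e, which is negative. Hence a e = 0 and only the positive
  part of x is left.\<close>

lemma cpos_adj_mult: "cpos (adj a * (a::'a))"
proof -
  define x where "x = adj a * a"
  have "adj x = x" by (simp add: x_def adj_simps)
  then obtain e where e: "e \<in> projections" "\<And>z. z * x = x * z \<Longrightarrow> z * e = e * z"
      "cpos (- (x * e))" "cpos (x * (1 - e))"
    using negative_part_projection by blast
  have "adj (a * e) * (a * e) = e * x * e"
    by (simp add: x_def adj_simps projectionsD(1)[OF e(1)] mult.assoc)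
  also have "\<dots> = x * e" using e(2)[of x] projectionsD(2)[OF e(1)] by (metis mult.assoc)
  finally have "a * e = 0" using e(3) by (intro cpos_neg_adj_mult) simp
  then have "x * e = 0" by (simp add: x_def mult.assoc)
  then show ?thesis using e(4) by (simp add: x_def algebra_simps)
qed

section \<open>The Loewner order and meets of projections\<close>

lemma loewner_iff_cpos: "loewner x y \<longleftrightarrow> cpos (y - x :: 'a)"
  unfolding loewner_def using cpos_adj_mult cpos_def by metis

lemma cpos_conj:
  assumes "cpos (x::'a)" shows "cpos (adj z * x * z)"
proof -
  obtain h where "adj h = h" "x = h * h" using assms cpos_def by blast
  then have "adj z * x * z = adj (h * z) * (h * z)" by (simp add: adj_simps mult.assoc)
  then show ?thesis using cpos_adj_mult by simp
qed

text \<open>Compressing q - p by 1 - q leaves minus an element \<open>adj a * a\<close> with a = p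
  (1 - q), and this is positive only for a = 0.\<close>

lemma loewner_projection_iff:
  assumes "(p::'a) \<in> projections" "q \<in> projections"
  shows "loewner p q \<longleftrightarrow> p * q = p"
proof
  note P = projectionsD[OF assms(1)] projectionsD[OF assms(2)]
  assume "loewner p q"
  then have "cpos (adj (1 - q) * (q - p) * (1 - q))" by (intro cpos_conj) (simp add: loewner_iff_cpos)
  also have "adj (1 - q) * (q - p) * (1 - q) = - (adj (p * (1 - q)) * (p * (1 - q)))"
  proof -
    have "(1 - q) * q = 0" "q * (1 - q) = 0" using P by (simp_all add: algebra_simps)
    moreover have "p * (p * (1 - q)) = p * (1 - q)" using P by (simp flip: mult.assoc)
    ultimately show ?thesis using P
      by (simp add: adj_simps mult.assoc left_diff_distrib[of q p] right_diff_distrib[of "1-q" q])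
  qed
  finally have "p * (1 - q) = 0" by (rule cpos_neg_adj_mult)
  then show "p * q = p" by (simp add: algebra_simps)
next
  note P = projectionsD[OF assms(1)] projectionsD[OF assms(2)]
  assume pq: "p * q = p"
  then have "adj (p * q) = adj p" by simp
  then have "q * p = p" using P by (simp add: adj_simps)
  then have "q - p \<in> projections" using P pq by (simp add: projections_def adj_simps algebra_simps)
  then show "loewner p q" using cpos_projection loewner_iff_cpos by blast
qed

lemma loewner_projection_iff':
  assumes "(p::'a) \<in> projections" "q \<in> projections"
  shows "loewner p q \<longleftrightarrow> q * p = p"
proof -
  have "p * q = p \<longleftrightarrow> adj (p * q) = adj p" by (metis adj_adj)
  then show ?thesis using loewner_projection_iff[OF assms] projectionsD(1)[OF assms(1)] projectionsD(1)[OF assms(2)]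
    by (simp add: adj_mult)
qed

lemma loewner_refl [simp]: "loewner x (x::'a)"
  by (simp add: loewner_iff_cpos)

lemma loewner_trans: "loewner x y \<Longrightarrow> loewner y z \<Longrightarrow> loewner x (z::'a)"
  using cpos_add[of "y - x" "z - y"] by (simp add: loewner_iff_cpos)

lemma loewner_antisym: "loewner x y \<Longrightarrow> loewner y x \<Longrightarrow> x = (y::'a)"
  using cpos_antisym[of "y - x"] by (simp add: loewner_iff_cpos)

lemma loewner_compl_iff: "loewner (1 - x) (1 - y) \<longleftrightarrow> loewner y (x::'a)"
  by (simp add: loewner_iff_cpos)

lemma zero_loewner_projection: "p \<in> projections \<Longrightarrow> loewner 0 (p::'a)"
  and projection_loewner_one: "p \<in> projections \<Longrightarrow> loewner p (1::'a)"
  by (simp_all add: loewner_iff_cpos cpos_projection projection_compl)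

text \<open>The meet is the common annihilator of the complements. It lies in the bicommutant of A,
  which later transfers commutation from projections to their meets.\<close>

lemma projection_glb:
  fixes A :: "'a set"
  assumes "A \<noteq> {}" "A \<subseteq> projections"
  obtains e where "proj_glb A e" "\<And>z. (\<And>a. a \<in> A \<Longrightarrow> z * a = a * z) \<Longrightarrow> z * e = e * z"
proof -
  let ?S = "(\<lambda>a. 1 - a) ` A"
  obtain e where e: "e \<in> projections" "\<And>x. (\<forall>s\<in>?S. s * x = 0) \<longleftrightarrow> e * x = x"
    "\<And>z. (\<And>s. s \<in> ?S \<Longrightarrow> z * s = s * z) \<Longrightarrow> z * e = e * z"
  proof (rule sa_annihilator[of ?S])
    show "?S \<noteq> {}" using assms by simp
    show "adj s = s" if "s \<in> ?S" for s
      using that assms(2) by (auto simp: adj_simps projections_def)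
  qed blast
  have ex: "(\<forall>a\<in>A. a * x = x) \<longleftrightarrow> e * x = x" for x
    using e(2)[of x] by (auto simp: algebra_simps)
  have "proj_glb A e" unfolding proj_glb_def
  proof (intro conjI ballI impI)
    show "e \<in> projections" by (fact e(1))
    show "loewner e a" if "a \<in> A" for a
      using ex[of e] that e(1) assms projectionsD(2)[OF e(1)] loewner_projection_iff' by blast
    show "loewner q e" if "q \<in> projections" "\<forall>a\<in>A. loewner q a" for q
      using ex[of q] that e(1) assms loewner_projection_iff' by blast
  qed
  moreover have "z * e = e * z" if "\<And>a. a \<in> A \<Longrightarrow> z * a = a * z" for z
    by (rule e(3)) (use that in \<open>auto simp: algebra_simps\<close>)
  ultimately show thesis using that by blast
qed

section \<open>Spectral families\<close>

text \<open>On r = p (1 - q) the element x is at most l and at least m > l, which forces r =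
  0.\<close>

lemma spectral_projections_le:
  fixes x :: 'a
  assumes "p \<in> projections" "q \<in> projections" "p * q = q * p" "x * p = p * x" "x * q = q * x"
    "cpos (l *\<^sub>R p - x * p)" "cpos (x * (1 - q) - m *\<^sub>R (1 - q))" "l < m"
  shows "loewner p q"
proof -
  define r where "r = p * (1 - q)"
  have c: "p * (1 - q) = (1 - q) * p" "x * (1 - q) = (1 - q) * x"
    using assms by (simp_all add: algebra_simps)
  have r: "r \<in> projections" unfolding r_def using assms c by (intro projection_mult projection_compl)
  have "cpos ((l *\<^sub>R p - x * p) * (1 - q))"
  proof (intro cpos_mult assms cpos_projection projection_compl)
    show "(l *\<^sub>R p - x * p) * (1 - q) = (1 - q) * (l *\<^sub>R p - x * p)"
      by (intro commute_intros) (use assms(3-5) in auto)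
  qed
  moreover have "cpos ((x * (1 - q) - m *\<^sub>R (1 - q)) * p)"
  proof (intro cpos_mult assms cpos_projection projection_compl)
    show "(x * (1 - q) - m *\<^sub>R (1 - q)) * p = p * (x * (1 - q) - m *\<^sub>R (1 - q))"
      by (intro commute_intros) (use assms(3-5) in auto)
  qed
  ultimately have "cpos ((l *\<^sub>R p - x * p) * (1 - q) + (x * (1 - q) - m *\<^sub>R (1 - q)) * p)"
    by (rule cpos_add)
  also have "(l *\<^sub>R p - x * p) * (1 - q) + (x * (1 - q) - m *\<^sub>R (1 - q)) * p = - ((m - l) *\<^sub>R r)"
    unfolding r_def using assms(3) by (simp add: algebra_simps)
  finally have "(m - l) *\<^sub>R r = 0"
    using cpos_scaleR[OF cpos_projection[OF r], of "m - l"] assms(8) by (intro cpos_antisym) auto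
  then have "p * (1 - q) = 0" using assms(8) by (simp add: r_def)
  then show ?thesis using loewner_projection_iff[OF assms(1,2)] by (simp add: algebra_simps)
qed

text \<open>The inequalities in \<open>is_spectral_family\<close> contain commutation: positivity of
  the difference makes x p self-adjoint.\<close>

lemma commutes_of_cpos:
  fixes x :: 'a
  assumes "adj x = x" "p \<in> projections" "cpos (l *\<^sub>R p - x * p)" shows "x * p = p * x"
proof -
  have "adj (l *\<^sub>R p - x * p) = l *\<^sub>R p - x * p" using cpos_adj assms by blast
  then show ?thesis using assms(1) projectionsD(1)[OF assms(2)] by (simp add: adj_simps)
qed

text \<open>\<open>E l\<close> is the negative part projection of x - l. Its place in the
  bicommutant of x is recorded because uniqueness rests on it.\<close>

lemma spectral_family_exists:
  fixes x :: 'a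
  assumes x: "adj x = x"
  shows "\<exists>E. is_spectral_family x E \<and> (\<forall>z l. z * x = x * z \<longrightarrow> z * E l = E l * z)"
proof -
  have "\<forall>l. \<exists>e\<in>projections. (\<forall>z. z * (x - l *\<^sub>R 1) = (x - l *\<^sub>R 1) * z \<longrightarrow> z * e = e * z) \<and>
      cpos (- ((x - l *\<^sub>R 1) * e)) \<and> cpos ((x - l *\<^sub>R 1) * (1 - e)) \<and>
      (\<forall>r. (x - l *\<^sub>R 1) * (1 - e) * r = 0 \<longrightarrow> e * r = r)"
    by (intro allI negative_part_projection) (simp add: adj_simps x)
  then obtain E where E: "\<And>l. E l \<in> projections"
    "\<And>l z. z * (x - l *\<^sub>R 1) = (x - l *\<^sub>R 1) * z \<Longrightarrow> z * E l = E l * z"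
    "\<And>l. cpos (- ((x - l *\<^sub>R 1) * E l))" "\<And>l. cpos ((x - l *\<^sub>R 1) * (1 - E l))"
    "\<And>l r. (x - l *\<^sub>R 1) * (1 - E l) * r = 0 \<Longrightarrow> E l * r = r" by metis
  have com: "z * E l = E l * z" if "z * x = x * z" for z l
    by (rule E(2)) (simp add: algebra_simps that)
  have xE: "x * E l = E l * x" for l by (rule com) simp
  have EE: "E l * E m = E m * E l" for l m by (rule com) (simp add: xE)
  have up: "cpos (l *\<^sub>R E l - x * E l)" and lo: "cpos (x * (1 - E l) - l *\<^sub>R (1 - E l))" for l
    using E(3,4)[of l] by (simp_all add: algebra_simps)
  have mono: "loewner (E l) (E m)" if "l \<le> m" for l m
    using that spectral_projections_le[OF E(1) E(1) EE xE xE up lo, of l m] by (cases "l = m") auto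
  have glb: "proj_glb {E m | m. m > l} (E l)" for l
  proof -
    have "{E m | m. m > l} \<noteq> {}" by (auto intro: exI[of _ "l + 1"])
    moreover have "{E m | m. m > l} \<subseteq> projections" using E by auto
    ultimately obtain F where F: "proj_glb {E m | m. m > l} F"
        "\<And>z. (\<And>a. a \<in> {E m | m. m > l} \<Longrightarrow> z * a = a * z) \<Longrightarrow> z * F = F * z"
      by (rule projection_glb) blast
    have Fp: "F \<in> projections" using F by (simp add: proj_glb_def)
    have Fx: "x * F = F * x" using xE by (intro F(2)) auto
    have FE: "E m * F = F * E m" for m using EE by (intro F(2)) auto
    have mF: "cpos (m *\<^sub>R F - x * F)" if "m > l" for m
    proof -
      have "loewner F (E m)" using F(1) that by (auto simp: proj_glb_def)
      then have *: "E m * F = F" using loewner_projection_iff' Fp E by blast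
      have "cpos ((m *\<^sub>R E m - x * E m) * F)"
      proof (intro cpos_mult up cpos_projection Fp)
        show "(m *\<^sub>R E m - x * E m) * F = F * (m *\<^sub>R E m - x * E m)"
          by (intro commute_intros) (simp_all add: Fx FE)
      qed
      then show ?thesis by (simp add: left_diff_distrib mult.assoc *)
    qed
    \<comment> \<open>On the meet F the element x is at most every m > l, hence at most l.\<close>
    have "cpos ((l *\<^sub>R F - x * F) + d *\<^sub>R F)" if "d > 0" for d
      using mF[of "l + d"] that by (simp add: algebra_simps)
    then have 1: "cpos (l *\<^sub>R F - x * F)" by (rule cpos_of_eps)
    have "cpos ((l *\<^sub>R F - x * F) * (1 - E l))"
    proof (intro cpos_mult 1 cpos_projection projection_compl E)
      show "(l *\<^sub>R F - x * F) * (1 - E l) = (1 - E l) * (l *\<^sub>R F - x * F)"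
        by (intro commute_intros) (simp_all add: xE FE)
    qed
    moreover have "cpos ((x * (1 - E l) - l *\<^sub>R (1 - E l)) * F)"
    proof (intro cpos_mult lo cpos_projection Fp)
      show "(x * (1 - E l) - l *\<^sub>R (1 - E l)) * F = F * (x * (1 - E l) - l *\<^sub>R (1 - E l))"
        by (intro commute_intros) (simp_all add: Fx FE)
    qed
    moreover have "(l *\<^sub>R F - x * F) * (1 - E l) = - ((x - l *\<^sub>R 1) * (1 - E l) * F)"
      by (simp add: algebra_simps FE)
    moreover have "(x * (1 - E l) - l *\<^sub>R (1 - E l)) * F = (x - l *\<^sub>R 1) * (1 - E l) * F"
      by (simp add: algebra_simps)
    \<comment> \<open>On F cut by 1 - E l the element x - l is both nonpositive and nonnegative. The
      kernel clause of \<open>negative_part_projection\<close> then puts F below E l.\<close>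
    ultimately have "(x - l *\<^sub>R 1) * (1 - E l) * F = 0" by (metis cpos_antisym)
    then have "E l * F = F" by (rule E(5))
    then have "loewner F (E l)" using loewner_projection_iff' Fp E by blast
    then show ?thesis using F(1) E(1) mono unfolding proj_glb_def
      by (auto intro: loewner_trans)
  qed
  have "E l = 0" if "l < - norm x" for l
  proof -
    have "loewner (E l) 0"
      by (rule spectral_projections_le[where x=x and l=l and m="- norm x"])
        (use E xE up that cpos_norm_plus[OF x] in \<open>auto simp: add.commute\<close>)
    then show ?thesis using E(1) loewner_antisym zero_loewner_projection by blast
  qed
  moreover have "E l = 1" if "l > norm x" for l
  proof -
    have "loewner 1 (E l)"
      by (rule spectral_projections_le[where x=x and m=l and l="norm x"])
        (use E xE lo that cpos_norm_minus[OF x] in auto)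
    then show ?thesis using E(1) loewner_antisym projection_loewner_one by blast
  qed
  ultimately have "\<exists>a>0. (\<forall>l< -a. E l = 0) \<and> (\<forall>l>a. E l = 1)"
    by (intro exI[of _ "norm x + 1"]) (auto simp: add_nonneg_pos)
  then have "is_spectral_family x E"
    unfolding is_spectral_family_def using E(1) mono glb up lo by (simp add: loewner_iff_cpos)
  then show ?thesis using com by blast
qed

text \<open>Strict inequality l < m allows a comparison of E l with F m; right continuity of F lets
  m decrease to l.\<close>

lemma spectral_family_le:
  fixes x :: 'a
  assumes x: "adj x = x" and E: "is_spectral_family x E" and F: "is_spectral_family x F"
    and com: "\<And>l m. E l * F m = F m * E l"
  shows "loewner (E l) (F l)"
proof -
  have "loewner (E l) (F m)" if "l < m" for m
  proof (rule spectral_projections_le[OF _ _ com _ _ _ _ that])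
    show p: "E l \<in> projections" "F m \<in> projections" using E F
      by (auto simp: is_spectral_family_def)
    show c: "cpos (l *\<^sub>R E l - x * E l)" "cpos (x * (1 - F m) - m *\<^sub>R (1 - F m))"
      using E F by (auto simp: is_spectral_family_def loewner_iff_cpos)
    show "x * E l = E l * x" by (rule commutes_of_cpos[OF x p(1) c(1)])
    show "x * F m = F m * x" using F
      by (intro commutes_of_cpos[OF x p(2), where l=m]) (auto simp: is_spectral_family_def loewner_iff_cpos)
  qed
  moreover have "proj_glb {F m |m. l < m} (F l)" "E l \<in> projections"
    using E F by (auto simp: is_spectral_family_def)
  ultimately show ?thesis unfolding proj_glb_def by blast
qed

text \<open>One family in the bicommutant is enough: any F commutes with x, hence with E, and then
  the two dominate each other.\<close>

lemma spectral_family_unique_aux: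
  fixes x :: 'a
  assumes x: "adj x = x" and E: "is_spectral_family x E"
    and com: "\<And>z l. z * x = x * z \<Longrightarrow> z * E l = E l * z" and F: "is_spectral_family x F"
  shows "F = E"
proof -
  have "x * F l = F l * x" for l using F
    by (intro commutes_of_cpos[OF x, where l=l]) (auto simp: is_spectral_family_def loewner_iff_cpos)
  then have "F m * E l = E l * F m" for l m by (intro com) simp
  then show ?thesis
    using spectral_family_le[OF x E F] spectral_family_le[OF x F E] loewner_antisym by auto
qed

lemma is_spectral_family_spec: "adj (x::'a) = x \<Longrightarrow> is_spectral_family x (spec x)"
  and spec_commutes: "adj (x::'a) = x \<Longrightarrow> z * x = x * z \<Longrightarrow> z * spec x l = spec x l * z"
  and spec_eqI: "adj (x::'a) = x \<Longrightarrow> is_spectral_family x F \<Longrightarrow> spec x = F"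
proof -
  assume x: "adj x = x"
  obtain E where E: "is_spectral_family x E" "\<And>z l. z * x = x * z \<Longrightarrow> z * E l = E l * z"
    using spectral_family_exists[OF x] by blast
  have "spec x = E" unfolding spec_def
    using spectral_family_unique_aux[OF x E] E(1) by blast
  then show "is_spectral_family x (spec x)" "z * x = x * z \<Longrightarrow> z * spec x l = spec x l * z"
    "is_spectral_family x F \<Longrightarrow> spec x = F"
    using E(1) E(2)[of z l] spectral_family_unique_aux[OF x E, of F] by blast+
qed

end

text \<open>The projection carries the lower value, so for a < b a larger p gives a smaller
  step.\<close>

definition step :: "real \<Rightarrow> real \<Rightarrow> 'a::cstar_algebra \<Rightarrow> 'a" where
  "step a b p = a *\<^sub>R p + b *\<^sub>R (1 - p)"

lemma adj_step: "p \<in> projections \<Longrightarrow> adj (step a b p) = step a b p"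
  by (simp add: step_def adj_simps projectionsD)

context aw_star_algebra
begin

lemma
  fixes x :: 'a
  assumes "adj x = x"
  shows spec_projection: "spec x l \<in> projections"
    and spec_mono: "l \<le> m \<Longrightarrow> loewner (spec x l) (spec x m)"
    and spec_upper: "cpos (l *\<^sub>R spec x l - x * spec x l)"
    and spec_lower: "cpos (x * (1 - spec x l) - l *\<^sub>R (1 - spec x l))"
    and spec_bounded: "\<exists>a>0. (\<forall>l< -a. spec x l = 0) \<and> (\<forall>l>a. spec x l = 1)"
  using is_spectral_family_spec[OF assms] unfolding is_spectral_family_def loewner_iff_cpos by blast+

lemma spec_rightI:
  fixes x :: 'a
  assumes "adj x = x" "q \<in> projections" "\<And>m. l < m \<Longrightarrow> loewner q (spec x m)"
  shows "loewner q (spec x l)"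
  using is_spectral_family_spec[OF assms(1)] assms(2,3)
  unfolding is_spectral_family_def proj_glb_def by blast

text \<open>Comparison with the projection 0, on whose complement x is at least - norm x. The
  unspecified bound of a spectral family is thereby replaced by the norm.\<close>

lemma spec_eq_0:
  fixes x :: 'a
  assumes x: "adj x = x" and l: "l < - norm x"
  shows "spec x l = 0"
proof -
  have "loewner (spec x l) 0"
    by (rule spectral_projections_le[where x=x and l=l and m="- norm x"])
      (use spec_projection[OF x] spec_upper[OF x] spec_commutes[OF x, of x] l cpos_norm_plus[OF x]
        in \<open>auto simp: add.commute\<close>)
  then show ?thesis using spec_projection[OF x] loewner_antisym zero_loewner_projection by blast
qed

lemma spec_eq_1:
  fixes x :: 'a
  assumes x: "adj x = x" and l: "norm x < l"
  shows "spec x l = 1"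
proof -
  have "loewner 1 (spec x l)"
    by (rule spectral_projections_le[where x=x and m=l and l="norm x"])
      (use spec_projection[OF x] spec_lower[OF x] spec_commutes[OF x, of x] l cpos_norm_minus[OF x] in auto)
  then show ?thesis using spec_projection[OF x] loewner_antisym projection_loewner_one by blast
qed

lemma spec_interval:
  fixes x :: 'a
  assumes x: "adj x = x" and "u \<le> v"
  defines "d \<equiv> spec x v - spec x u"
  shows "d \<in> projections" "cpos (v *\<^sub>R d - x * d)" "cpos (x * d - u *\<^sub>R d)"
proof -
  let ?U = "spec x u" and ?V = "spec x v"
  note P = spec_projection[OF x]
  have UV: "?U * ?V = ?U" "?V * ?U = ?U"
    using spec_mono[OF x assms(2)] loewner_projection_iff loewner_projection_iff' P by blast+
  have xU: "x * ?U = ?U * x" and xV: "x * ?V = ?V * x" using spec_commutes[OF x, of x] by simp_all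
  show "d \<in> projections"
    using UV projectionsD[OF P] by (simp add: d_def projections_def adj_simps algebra_simps)
  have "cpos ((v *\<^sub>R ?V - x * ?V) * (1 - ?U))"
    by (intro cpos_mult spec_upper x cpos_projection projection_compl P commute_intros)
      (simp_all add: UV xU)
  then show "cpos (v *\<^sub>R d - x * d)" by (simp add: d_def algebra_simps UV)
  have "cpos ((x * (1 - ?U) - u *\<^sub>R (1 - ?U)) * ?V)"
    by (intro cpos_mult spec_lower x cpos_projection projection_compl P commute_intros)
      (simp_all add: UV xV)
  then show "cpos (x * d - u *\<^sub>R d)" by (simp add: d_def algebra_simps UV)
qed

text \<open>On a common spectral piece of width below e, x is at most the upper and y at least the
  lower end, so x - y is at most e there. Adding up pieces bounds x - y by e, and the roles can be
  exchanged.\<close>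

lemma spec_inj:
  fixes x y :: 'a
  assumes x: "adj x = x" and y: "adj y = y" and eq: "spec x = spec y"
  shows "x = y"
proof -
  have one: "cpos (e *\<^sub>R 1 - (x - y))"
    if x: "adj x = x" and y: "adj y = y" and eq: "spec x = spec y" and e: "e > 0" for e and x y :: 'a
  proof -
    \<comment> \<open>Strictly beyond the norm, so that the spectral projections at - N and N are 0
      and 1.\<close>
    define N where "N = norm x + 1"
    have "- N \<le> N" by (simp add: N_def)
    then have "cpos (e *\<^sub>R (spec x N - spec x (- N)) - (x - y) * (spec x N - spec x (- N)))"
    proof (induction rule: Bolzano)
      case (trans a b c)
      from cpos_add[OF trans(1,2)] show ?case by (simp add: algebra_simps)
    next
      case (local t)
      have "cpos (e *\<^sub>R (spec x v - spec x u) - (x - y) * (spec x v - spec x u))"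
        if "u \<le> t" "t \<le> v" "v - u < e" for u v
      proof -
        define d where "d = spec x v - spec x u"
        have uv: "u \<le> v" using that by simp
        have d: "d \<in> projections" "cpos (v *\<^sub>R d - x * d)" "cpos (y * d - u *\<^sub>R d)"
          using spec_interval[OF x uv] spec_interval[OF y uv] by (simp_all add: d_def eq)
        have "cpos ((e - (v - u)) *\<^sub>R d)" using that d by (intro cpos_scaleR cpos_projection) auto
        from cpos_add[OF cpos_add[OF d(2,3)] this] show ?thesis
          unfolding d_def[symmetric] by (simp add: algebra_simps)
      qed
      then show ?case using e by blast
    qed
    then show ?thesis using spec_eq_0[OF x, of "- N"] spec_eq_1[OF x, of N] by (simp add: N_def)
  qed
  have "norm (x - y) \<le> e" if "e > 0" for e
    using one[OF x y eq that] one[OF y x eq[symmetric] that] that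
    by (intro norm_le_of_cpos_both) (simp_all add: algebra_simps)
  then have "norm (x - y) \<le> 0" by (rule field_le_epsilon) simp
  then show ?thesis by simp
qed

text \<open>The case a = b is included because it covers the scalars.\<close>

lemma spec_step:
  assumes p: "(p::'a) \<in> projections" and ab: "a \<le> b"
  shows "spec (step a b p) = (\<lambda>l. if l < a then 0 else if l < b then p else 1)" (is "_ = ?E")
proof (rule spec_eqI[OF adj_step[OF p]])
  have pp: "p * p = p" using p projectionsD by blast
  have E: "?E l \<in> projections" for l using p by auto
  have mono: "loewner (?E l) (?E m)" if "l \<le> m" for l m
    using that ab zero_loewner_projection[OF p] projection_loewner_one[OF p]
      zero_loewner_projection[OF projection_1] by auto
  have glb: "proj_glb {?E m |m. l < m} (?E l)" for l
    unfolding proj_glb_def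
  proof (intro conjI ballI impI E)
    show "loewner (?E l) e" if "e \<in> {?E m |m. l < m}" for e using that mono by fastforce
    fix q :: 'a assume q: "q \<in> projections" "\<forall>e\<in>{?E m |m. l < m}. loewner q e"
    then have q2: "loewner q (?E m)" if "l < m" for m using that by blast
    consider "l < a" | "a \<le> l" "l < b" | "a \<le> l" "b \<le> l" by linarith
    then show "loewner q (?E l)"
    proof cases
      \<comment> \<open>The midpoint lies to the right of l, but still in the piece on which the
        family keeps its value at l.\<close>
      case 1 then show ?thesis using q2[of "(l + a) / 2"] by simp
    next
      case 2
      then have "\<not> (l + b) / 2 < a" "(l + b) / 2 < b" "l < (l + b) / 2" by auto
      then show ?thesis using q2[of "(l + b) / 2"] 2 by simp
    next
      case 3 then show ?thesis using projection_loewner_one q by simp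
    qed
  qed
  have bd: "\<exists>c>0. (\<forall>l< -c. ?E l = 0) \<and> (\<forall>l>c. ?E l = 1)"
    by (intro exI[of _ "\<bar>a\<bar> + \<bar>b\<bar> + 1"]) (use ab in auto)
  have pos: "0 \<le> s \<Longrightarrow> 0 \<le> t \<Longrightarrow> cpos (s *\<^sub>R p + t *\<^sub>R (1 - p))" for s t
    by (intro cpos_add cpos_scaleR cpos_projection projection_compl p)
  have sp: "step a b p * p = a *\<^sub>R p" "step a b p * (1 - p) = b *\<^sub>R (1 - p)"
    by (simp_all add: step_def algebra_simps pp)
  have up: "cpos (l *\<^sub>R ?E l - step a b p * ?E l)" for l
  proof -
    consider "l < a" | "a \<le> l" "l < b" | "a \<le> l" "b \<le> l" by linarith
    then show ?thesis
    proof cases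
      case 1 then show ?thesis by simp
    next
      case 2 then show ?thesis using pos[of "l - a" 0] by (simp add: sp algebra_simps)
    next
      case 3 then show ?thesis using pos[of "l - a" "l - b"] by (simp add: step_def algebra_simps)
    qed
  qed
  have lo: "cpos (step a b p * (1 - ?E l) - l *\<^sub>R (1 - ?E l))" for l
  proof -
    consider "l < a" | "a \<le> l" "l < b" | "a \<le> l" "b \<le> l" by linarith
    then show ?thesis
    proof cases
      case 1 then show ?thesis using ab pos[of "a - l" "b - l"] by (simp add: step_def algebra_simps)
    next
      case 2 then show ?thesis using pos[of 0 "b - l"] by (simp add: sp) (simp add: algebra_simps)
    next
      case 3 then show ?thesis by simp
    qed
  qed
  show "is_spectral_family (step a b p) ?E"
    unfolding is_spectral_family_def loewner_iff_cpos[of "_ * _"] loewner_iff_cpos[of "_ *\<^sub>R _"]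
    using E mono glb bd up lo by blast
qed

end

section \<open>Functional calculus\<close>

lemma poly_eval_eq_sum:
  assumes "degree p \<le> n" shows "poly_eval p (x::'a::cstar_algebra) = (\<Sum>i\<le>n. coeff p i *\<^sub>R x ^ i)"
  unfolding poly_eval_def
  by (rule sum.mono_neutral_left) (use assms in \<open>auto simp: coeff_eq_0\<close>)

lemma poly_eval_pCons: "poly_eval (pCons a p) (x::'a::cstar_algebra) = a *\<^sub>R 1 + x * poly_eval p x"
proof -
  have "poly_eval (pCons a p) x = (\<Sum>i\<le>Suc (degree p). coeff (pCons a p) i *\<^sub>R x ^ i)"
    by (rule poly_eval_eq_sum) (rule degree_pCons_le)
  also have "\<dots> = a *\<^sub>R 1 + (\<Sum>i\<le>degree p. x * (coeff p i *\<^sub>R x ^ i))"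
    by (subst sum.atMost_Suc_shift) simp
  finally show ?thesis by (simp add: poly_eval_def sum_distrib_left)
qed

lemma poly_eval_0 [simp]: "poly_eval 0 (x::'a::cstar_algebra) = 0"
  by (simp add: poly_eval_def)

lemma poly_eval_diff: "poly_eval (p - q) (x::'a::cstar_algebra) = poly_eval p x - poly_eval q x"
proof -
  let ?n = "max (degree p) (degree q)"
  show ?thesis
    using poly_eval_eq_sum[of p ?n x] poly_eval_eq_sum[of q ?n x] poly_eval_eq_sum[of "p - q" ?n x]
      degree_diff_le_max[of p q]
    by (simp add: sum_subtractf scaleR_diff_left)
qed

lemma poly_eval_const: "poly_eval [:c:] (x::'a::cstar_algebra) = c *\<^sub>R 1"
  by (simp add: poly_eval_def)

lemma adj_poly_eval: "adj x = x \<Longrightarrow> adj (poly_eval p (x::'a::cstar_algebra)) = poly_eval p x"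
  unfolding poly_eval_def
    by (simp add: linear_sum[OF bounded_linear.linear[OF bounded_linear_adj]] adj_simps)

lemma poly_eval_commutes:
  assumes "z * x = x * z" shows "z * poly_eval p (x::'a::cstar_algebra) = poly_eval p x * z"
proof (induction p)
  case (pCons a p)
  have "z * (a *\<^sub>R 1 + x * poly_eval p x) = a *\<^sub>R z + (z * x) * poly_eval p x"
    by (simp add: algebra_simps)
  also have "\<dots> = (a *\<^sub>R 1 + x * poly_eval p x) * z"
    unfolding assms using pCons.IH by (simp add: algebra_simps)
  finally show ?case by (simp add: poly_eval_pCons)
qed simp

text \<open>The factor theorem in the algebra: near t the deviation of p(x) from p(t) is controlled
  by x - t, with one fixed g.\<close>

lemma poly_eval_factor: "\<exists>g. poly_eval p (x::'a::cstar_algebra) - poly p t *\<^sub>R 1 = g * (x - t *\<^sub>R 1)"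
proof (induction p)
  case 0
  show ?case by (rule exI[of _ 0]) simp
next
  case (pCons a p)
  then obtain g where g: "poly_eval p x - poly p t *\<^sub>R 1 = g * (x - t *\<^sub>R 1)" by blast
  have "poly_eval (pCons a p) x - poly (pCons a p) t *\<^sub>R 1 =
      x * (poly_eval p x - poly p t *\<^sub>R 1) + poly p t *\<^sub>R (x - t *\<^sub>R 1)"
    by (simp add: poly_eval_pCons algebra_simps)
  also have "\<dots> = (x * g + poly p t *\<^sub>R 1) * (x - t *\<^sub>R 1)"
    unfolding g by (simp add: distrib_right mult.assoc)
  finally show ?case by blast
qed

context aw_star_algebra
begin

text \<open>Bisection: on a spectral piece of small width around \<open>t\<close> the element \<open>p(x)\<close> is close to \<open>p(t)\<close>,
  and the estimates on adjacent pieces add up.\<close>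

lemma poly_eval_cpos:
  fixes x :: 'a
  assumes x: "adj x = x" and ab: "\<alpha> \<le> \<beta>" and p: "\<And>t. \<alpha> \<le> t \<Longrightarrow> t \<le> \<beta> \<Longrightarrow> 0 \<le> poly p t"
    and r: "r \<in> projections" "x * r = r * x"
    and lo: "cpos (x * r - \<alpha> *\<^sub>R r)" and up: "cpos (\<beta> *\<^sub>R r - x * r)"
  shows "cpos (poly_eval p x * r)"
proof (rule cpos_of_eps[where y=r])
  fix e :: real assume e: "0 < e"
  define P where "P u v \<longleftrightarrow> (\<forall>s. s \<in> projections \<longrightarrow> x * s = s * x \<longrightarrow> cpos (x * s - u *\<^sub>R s) \<longrightarrow>
    cpos (v *\<^sub>R s - x * s) \<longrightarrow> cpos (poly_eval p x * s + e *\<^sub>R s))" for u v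
  have "P \<alpha> \<beta>" using ab
  proof (induction rule: Bolzano)
    case (trans a b c)
    show ?case unfolding P_def
    proof (intro allI impI)
      fix s assume s: "s \<in> projections" "x * s = s * x" "cpos (x * s - a *\<^sub>R s)" "cpos (c *\<^sub>R s - x * s)"
      let ?E = "spec x b"
      have xE: "x * ?E = ?E * x" and sE: "s * ?E = ?E * s" using spec_commutes[OF x] s(2) by simp_all
      have Ep: "?E \<in> projections" by (rule spec_projection[OF x])
      define f where "f = s * ?E"
      define g where "g = s * (1 - ?E)"
      have fp: "f \<in> projections" unfolding f_def by (intro projection_mult s Ep sE)
      have gp: "g \<in> projections" unfolding g_def
        by (intro projection_mult projection_compl s Ep commute_intros sE)
      have "cpos (poly_eval p x * f + e *\<^sub>R f)"
      proof (rule trans(1)[unfolded P_def, rule_format, OF fp])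
        show "x * f = f * x" unfolding f_def by (intro commute_intros s xE)
        have "cpos ((x * s - a *\<^sub>R s) * ?E)"
          by (intro cpos_mult s cpos_projection Ep commute_intros xE sE)
        then show "cpos (x * f - a *\<^sub>R f)" by (simp add: f_def algebra_simps)
        have "cpos ((b *\<^sub>R ?E - x * ?E) * s)"
          by (intro cpos_mult s cpos_projection Ep commute_intros spec_upper x) (simp_all add: sE)
        then show "cpos (b *\<^sub>R f - x * f)" by (simp add: f_def algebra_simps sE)
      qed
      moreover have "cpos (poly_eval p x * g + e *\<^sub>R g)"
      proof (rule trans(2)[unfolded P_def, rule_format, OF gp])
        show "x * g = g * x" unfolding g_def by (intro commute_intros s xE)
        have "cpos ((x * (1 - ?E) - b *\<^sub>R (1 - ?E)) * s)"
          by (intro cpos_mult s cpos_projection Ep commute_intros spec_lower x) (simp_all add: sE)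
        then show "cpos (x * g - b *\<^sub>R g)" by (simp add: g_def algebra_simps sE)
        have "cpos ((c *\<^sub>R s - x * s) * (1 - ?E))"
          by (intro cpos_mult s cpos_projection projection_compl Ep commute_intros xE sE)
        then show "cpos (c *\<^sub>R g - x * g)" by (simp add: g_def algebra_simps)
      qed
      ultimately have "cpos ((poly_eval p x * f + e *\<^sub>R f) + (poly_eval p x * g + e *\<^sub>R g))"
        by (rule cpos_add)
      moreover have "s = f + g" by (simp add: f_def g_def algebra_simps)
      ultimately show "cpos (poly_eval p x * s + e *\<^sub>R s)" by (simp add: algebra_simps)
    qed
  next
    case (local t)
    obtain g where g: "poly_eval p x - poly p t *\<^sub>R 1 = g * (x - t *\<^sub>R 1)"
      using poly_eval_factor by blast
    \<comment> \<open>The width that keeps norm g times d at most e; \<open>+ 1\<close> covers g =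
      0.\<close>
    define d where "d = e / (norm g + 1)"
    have n1: "norm g + 1 > 0" by (simp add: add_nonneg_pos)
    have d: "d > 0" using e n1 by (simp add: d_def)
    have "P u v" if uv: "u \<le> t" "t \<le> v" "v - u < d" for u v
      unfolding P_def
    proof (intro allI impI)
      fix s assume s: "s \<in> projections" "x * s = s * x" "cpos (x * s - u *\<^sub>R s)" "cpos (v *\<^sub>R s - x * s)"
      have ss: "s * s = s" using s projectionsD by blast
      define y where "y = (x - t *\<^sub>R 1) * s"
      have "norm y \<le> d"
      proof (rule norm_le_of_cpos_both)
        have "cpos (d *\<^sub>R (1 - s) + (d - (v - t)) *\<^sub>R s + (v *\<^sub>R s - x * s))"
          using uv by (intro cpos_add cpos_scaleR cpos_projection projection_compl s) (use d in auto)
        then show "cpos (d *\<^sub>R 1 - y)" by (simp add: y_def algebra_simps)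
        have "cpos (d *\<^sub>R (1 - s) + (d - (t - u)) *\<^sub>R s + (x * s - u *\<^sub>R s))"
          using uv by (intro cpos_add cpos_scaleR cpos_projection projection_compl s) (use d in auto)
        then show "cpos (d *\<^sub>R 1 + y)" by (simp add: y_def algebra_simps)
      qed (use d in simp)
      define w where "w = (poly_eval p x - poly p t *\<^sub>R 1) * s"
      have "w = g * y" by (simp add: w_def g y_def mult.assoc)
      then have "norm w \<le> norm g * norm y" by (simp add: norm_mult_ineq)
      also have "\<dots> \<le> norm g * d" using \<open>norm y \<le> d\<close>
        by (simp add: mult_left_mono)
      also have "\<dots> \<le> e" using e n1 by (simp add: d_def field_simps)
      finally have we: "norm w \<le> e" .
      have pes: "poly_eval p x * s = s * poly_eval p x"
        using poly_eval_commutes[of s x p] s(2) by simp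
      have wa: "adj w = w"
        using pes adj_poly_eval[OF x] projectionsD(1)[OF s(1)]
          by (simp add: w_def adj_simps algebra_simps)
      have ws: "w * s = w" by (simp add: w_def mult.assoc ss)
      have "s * w = w * s" unfolding w_def by (intro commute_intros) (simp_all add: pes)
      note ws = ws this[unfolded ws]
      have "cpos (norm w *\<^sub>R 1 + w)" by (rule cpos_norm_plus[OF wa])
      then have "cpos ((norm w *\<^sub>R 1 + w) * s)"
        by (rule cpos_mult[OF _ cpos_projection[OF s(1)]]) (simp add: distrib_left distrib_right ws)
      \<comment> \<open>The three terms add up to p(x) s + e s.\<close>
      then have "cpos ((norm w *\<^sub>R 1 + w) * s + (e - norm w) *\<^sub>R s + poly p t *\<^sub>R s)"
        using we p[OF local]
        by (intro cpos_add cpos_scaleR[OF cpos_projection[OF s(1)]]) auto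
      moreover have "poly_eval p x * s = w + poly p t *\<^sub>R s" by (simp add: w_def algebra_simps)
      ultimately show "cpos (poly_eval p x * s + e *\<^sub>R s)"
        by (simp add: distrib_right ws algebra_simps)
    qed
    then show ?case using d by blast
  qed
  then show "cpos (poly_eval p x * r + e *\<^sub>R r)" unfolding P_def using r lo up by blast
qed

text \<open>Nonnegativity of M - p and M + p on the interval passes to p(x). This bound takes the
  place of the spectral mapping theorem.\<close>

lemma norm_poly_eval_le:
  fixes x :: 'a
  assumes x: "adj x = x" and p: "\<And>t. \<bar>t\<bar> \<le> norm x \<Longrightarrow> \<bar>poly p t\<bar> \<le> M"
  shows "norm (poly_eval p x) \<le> M"
proof -
  have M: "0 \<le> M" using p[of 0] by simp
  have q: "cpos (poly_eval q x * 1)" if "\<And>t. \<bar>t\<bar> \<le> norm x \<Longrightarrow> 0 \<le> poly q t" for q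
    by (rule poly_eval_cpos[OF x, of "- norm x" "norm x"])
      (use that cpos_norm_minus[OF x] cpos_norm_plus[OF x] in \<open>auto simp: add.commute\<close>)
  have "cpos (poly_eval ([:M:] - p) x)" using q[of "[:M:] - p"] p by (simp add: abs_le_iff)
  moreover have "cpos (poly_eval (p - [:- M:]) x)"
  proof -
    have "0 \<le> poly (p - [:- M:]) t" if "\<bar>t\<bar> \<le> norm x" for t using p[OF that] by simp
    then show ?thesis using q[of "p - [:- M:]"] by simp
  qed
  ultimately show ?thesis using M
    by (intro norm_le_of_cpos_both) (simp_all add: poly_eval_diff poly_eval_const add.commute)
qed

end

lemma uniform_poly_approx:
  fixes f :: "real \<Rightarrow> real"
  assumes "continuous_on {a..b} f"
  shows "\<exists>P :: nat \<Rightarrow> real poly. \<forall>e>0. eventually (\<lambda>n. \<forall>t\<in>{a..b}. \<bar>poly (P n) t - f t\<bar> < e) sequentially"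
proof -
  have "\<exists>p. \<forall>t\<in>{a..b}. \<bar>poly p t - f t\<bar> < inverse (real (Suc n))" for n
  proof -
    obtain g where g: "real_polynomial_function g" "\<And>t. t \<in> {a..b} \<Longrightarrow> \<bar>f t - g t\<bar> < inverse (real (Suc n))"
      using Stone_Weierstrass_real_polynomial_function[OF compact_Icc assms, of "inverse (real (Suc n))"] by auto
    obtain c k where "g = (\<lambda>t. \<Sum>i\<le>k. c i * t ^ i)"
      using g(1) by (auto simp: real_polynomial_function_iff_sum)
    then have "g t = poly (\<Sum>i\<le>(k::nat). monom (c i) i) t" for t
      by (simp add: poly_sum poly_monom)
    then have "\<forall>t\<in>{a..b}. \<bar>poly (\<Sum>i\<le>k. monom (c i) i) t - f t\<bar> < inverse (real (Suc n))"
      using g(2) by (simp add: abs_minus_commute)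
    then show ?thesis by blast
  qed
  then obtain P where P: "\<And>n t. t \<in> {a..b} \<Longrightarrow> \<bar>poly (P n) t - f t\<bar> < inverse (real (Suc n))" by metis
  have "eventually (\<lambda>n. \<forall>t\<in>{a..b}. \<bar>poly (P n) t - f t\<bar> < e) sequentially" if e: "e > 0" for e
  proof -
    have "eventually (\<lambda>n. inverse (real (Suc n)) < e) sequentially"
      using LIMSEQ_inverse_real_of_nat e by (rule order_tendstoD)
    then show ?thesis by eventually_elim (use P in \<open>fastforce intro: less_trans\<close>)
  qed
  then show ?thesis by blast
qed

context aw_star_algebra
begin

text \<open>Polynomials within e of f give elements within 2 e of each other, so all approximating
  sequences are Cauchy with the same limit. This settles the description in
  \<open>fcalc\<close>.\<close>

lemma fcalc_limit:
  fixes x :: 'a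
  assumes x: "adj x = x" and f: "continuous_on {- norm x..norm x} f"
  obtains P :: "nat \<Rightarrow> real poly" where
    "\<And>e. e > 0 \<Longrightarrow> eventually (\<lambda>n. \<forall>t\<in>{- norm x..norm x}. \<bar>poly (P n) t - f t\<bar> < e) sequentially"
    "(\<lambda>n. poly_eval (P n) x) \<longlonglongrightarrow> fcalc f x"
proof -
  let ?I = "{- norm x..norm x}"
  let ?conv = "\<lambda>P. \<forall>e>0. eventually (\<lambda>n. \<forall>t\<in>?I. \<bar>poly (P n) t - f t\<bar> < e) sequentially"
  obtain P where P: "?conv P" using uniform_poly_approx[OF f] by blast
  have near: "norm (poly_eval p x - poly_eval q x) \<le> 2 * e"
    if "\<forall>t\<in>?I. \<bar>poly p t - f t\<bar> < e" "\<forall>t\<in>?I. \<bar>poly q t - f t\<bar> < e" for p q e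
    unfolding poly_eval_diff[symmetric]
  proof (rule norm_poly_eval_le[OF x])
    fix t assume "\<bar>t\<bar> \<le> norm x"
    then have "t \<in> ?I" by auto
    then have "\<bar>poly p t - f t\<bar> < e" "\<bar>poly q t - f t\<bar> < e" using that by auto
    then show "\<bar>poly (p - q) t\<bar> \<le> 2 * e" by (simp add: abs_if split: if_splits)
  qed
  have "Cauchy (\<lambda>n. poly_eval (P n) x)"
  proof (rule CauchyI)
    fix e :: real assume "0 < e"
    then have e3: "0 < e / 3" by simp
    have "eventually (\<lambda>n. \<forall>t\<in>?I. \<bar>poly (P n) t - f t\<bar> < e / 3) sequentially"
      using P e3 by blast
    then obtain N where N: "\<And>n. n \<ge> N \<Longrightarrow> \<forall>t\<in>?I. \<bar>poly (P n) t - f t\<bar> < e / 3"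
      by (auto simp: eventually_sequentially)
    have "norm (poly_eval (P m) x - poly_eval (P n) x) < e" if "m \<ge> N" "n \<ge> N" for m n
      using near[OF N[OF that(1)] N[OF that(2)]] \<open>0 < e\<close> by simp
    then show "\<exists>M. \<forall>m\<ge>M. \<forall>n\<ge>M. norm (poly_eval (P m) x - poly_eval (P n) x) < e" by blast
  qed
  then obtain y where y: "(\<lambda>n. poly_eval (P n) x) \<longlonglongrightarrow> y"
    using Cauchy_convergent convergent_def by blast
  have Q: "(\<lambda>n. poly_eval (Q n) x) \<longlonglongrightarrow> y" if "?conv Q" for Q
  proof -
    have "(\<lambda>n. poly_eval (Q n) x - poly_eval (P n) x) \<longlonglongrightarrow> 0"
    proof (rule tendstoI)
      fix e :: real assume "0 < e"
      then have e3: "0 < e / 3" by simp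
      have "eventually (\<lambda>n. \<forall>t\<in>?I. \<bar>poly (P n) t - f t\<bar> < e / 3) sequentially"
        "eventually (\<lambda>n. \<forall>t\<in>?I. \<bar>poly (Q n) t - f t\<bar> < e / 3) sequentially"
        using P that e3 by blast+
      then show "eventually (\<lambda>n. dist (poly_eval (Q n) x - poly_eval (P n) x) 0 < e) sequentially"
      proof eventually_elim
        case (elim n)
        then show ?case using near[OF elim(2,1)] \<open>0 < e\<close> by simp
      qed
    qed
    from tendsto_add[OF this y] show ?thesis by simp
  qed
  have "fcalc f x = y" unfolding fcalc_def
  proof (rule the_equality)
    show "\<forall>P. ?conv P \<longrightarrow> (\<lambda>n. poly_eval (P n) x) \<longlonglongrightarrow> y" using Q by blast
    show "z = y" if "\<forall>P. ?conv P \<longrightarrow> (\<lambda>n. poly_eval (P n) x) \<longlonglongrightarrow> z" for z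
      using that P y LIMSEQ_unique by blast
  qed
  then show thesis using that P y by blast
qed

lemma adj_fcalc:
  fixes x :: 'a
  assumes "adj x = x" "continuous_on {- norm x..norm x} f"
  shows "adj (fcalc f x) = fcalc f x"
proof -
  obtain P where "(\<lambda>n. poly_eval (P n) x) \<longlonglongrightarrow> fcalc f x" using fcalc_limit[OF assms] by blast
  then show ?thesis by (rule adj_fixed_limit) (rule adj_poly_eval[OF assms(1)])
qed

text \<open>Late approximating polynomials satisfy the bound on f up to e, so
  \<open>poly_eval_cpos\<close> applies with slack e, which is removed at the end.\<close>

lemma fcalc_cpos:
  fixes x :: 'a
  assumes x: "adj x = x" and f: "continuous_on {- norm x..norm x} f" and ab: "\<alpha> \<le> \<beta>"
    and I: "- norm x \<le> \<alpha>" "\<beta> \<le> norm x"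
    and r: "r \<in> projections" "x * r = r * x"
    and lo: "cpos (x * r - \<alpha> *\<^sub>R r)" and up: "cpos (\<beta> *\<^sub>R r - x * r)"
  shows "(\<And>t. \<alpha> \<le> t \<Longrightarrow> t \<le> \<beta> \<Longrightarrow> f t \<le> c) \<Longrightarrow> cpos (c *\<^sub>R r - fcalc f x * r)"
    and "(\<And>t. \<alpha> \<le> t \<Longrightarrow> t \<le> \<beta> \<Longrightarrow> c \<le> f t) \<Longrightarrow> cpos (fcalc f x * r - c *\<^sub>R r)"
proof -
  obtain P where P: "\<And>e. e > 0 \<Longrightarrow> eventually (\<lambda>n. \<forall>t\<in>{- norm x..norm x}. \<bar>poly (P n) t - f t\<bar> < e) sequentially"
    "(\<lambda>n. poly_eval (P n) x) \<longlonglongrightarrow> fcalc f x" using fcalc_limit[OF x f] by blast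
  note pos = poly_eval_cpos[OF x ab _ r lo up]
  have N: "\<exists>N. \<forall>n. \<forall>t\<in>{\<alpha>..\<beta>}. \<bar>poly (P (n + N)) t - f t\<bar> < e" if e: "e > 0" for e
  proof -
    obtain N where "\<forall>n\<ge>N. \<forall>t\<in>{- norm x..norm x}. \<bar>poly (P n) t - f t\<bar> < e"
      using P(1)[OF e] unfolding eventually_sequentially by blast
    then show ?thesis using I by (intro exI[of _ N]) auto
  qed
  {
    assume fc: "\<And>t. \<alpha> \<le> t \<Longrightarrow> t \<le> \<beta> \<Longrightarrow> f t \<le> c"
    show "cpos (c *\<^sub>R r - fcalc f x * r)"
    proof (rule cpos_of_eps[where y=r])
      fix e :: real assume "0 < e"
      then obtain N where N: "\<And>n t. t \<in> {\<alpha>..\<beta>} \<Longrightarrow> \<bar>poly (P (n + N)) t - f t\<bar> < e" using N by blast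
      show "cpos (c *\<^sub>R r - fcalc f x * r + e *\<^sub>R r)"
      proof (rule cpos_limit)
        show "(\<lambda>n. c *\<^sub>R r - poly_eval (P (n + N)) x * r + e *\<^sub>R r) \<longlonglongrightarrow> c *\<^sub>R r - fcalc f x * r + e *\<^sub>R r"
          by (intro tendsto_intros LIMSEQ_ignore_initial_segment P)
        fix n
        have "cpos (poly_eval ([:c + e:] - P (n + N)) x * r)"
        proof (rule pos)
          fix t assume "\<alpha> \<le> t" "t \<le> \<beta>"
          then show "0 \<le> poly ([:c + e:] - P (n + N)) t" using N[of t n] fc[of t]
            by (simp add: abs_less_iff)
        qed
        then show "cpos (c *\<^sub>R r - poly_eval (P (n + N)) x * r + e *\<^sub>R r)"
          by (simp add: poly_eval_diff poly_eval_const algebra_simps)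
      qed
    qed
  }
  {
    assume fc: "\<And>t. \<alpha> \<le> t \<Longrightarrow> t \<le> \<beta> \<Longrightarrow> c \<le> f t"
    show "cpos (fcalc f x * r - c *\<^sub>R r)"
    proof (rule cpos_of_eps[where y=r])
      fix e :: real assume "0 < e"
      then obtain N where N: "\<And>n t. t \<in> {\<alpha>..\<beta>} \<Longrightarrow> \<bar>poly (P (n + N)) t - f t\<bar> < e" using N by blast
      show "cpos (fcalc f x * r - c *\<^sub>R r + e *\<^sub>R r)"
      proof (rule cpos_limit)
        show "(\<lambda>n. poly_eval (P (n + N)) x * r - c *\<^sub>R r + e *\<^sub>R r) \<longlonglongrightarrow> fcalc f x * r - c *\<^sub>R r + e *\<^sub>R r"
          by (intro tendsto_intros LIMSEQ_ignore_initial_segment P)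
        fix n
        have "cpos (poly_eval (P (n + N) - [:c - e:]) x * r)"
        proof (rule pos)
          fix t assume "\<alpha> \<le> t" "t \<le> \<beta>"
          then show "0 \<le> poly (P (n + N) - [:c - e:]) t" using N[of t n] fc[of t]
            by (simp add: abs_less_iff)
        qed
        then show "cpos (poly_eval (P (n + N)) x * r - c *\<^sub>R r + e *\<^sub>R r)"
          by (simp add: poly_eval_diff poly_eval_const algebra_simps)
      qed
    qed
  }
qed

text \<open>By monotonicity, f l bounds f(x) from above on the spectral projection of x at l and
  from below on its complement. So the family of x reparametrised by the inverse of f is the family
  of f(x).\<close>

lemma spec_fcalc:
  fixes x :: 'a and f :: "real \<Rightarrow> real"
  assumes x: "adj x = x" and f: "strict_mono f" "bij f"
  shows "adj (fcalc f x) = fcalc f x" "spec (fcalc f x) (f l) = spec x l"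
proof -
  have "continuous_on UNIV f"
    by (rule continuous_onI_mono) (use f in \<open>auto simp: bij_is_surj strict_mono_less_eq\<close>)
  then have c: "continuous_on {- norm x..norm x} f" by (rule continuous_on_subset) simp
  show sa: "adj (fcalc f x) = fcalc f x" by (rule adj_fcalc[OF x c])
  note cp = fcalc_cpos[OF x c]
  note P = spec_projection[OF x]
  define g where "g = inv f"
  have fg: "f (g m) = m" and gf: "g (f l) = l" for m l
    using f by (simp_all add: g_def bij_is_surj surj_f_inv_f bij_is_inj)
  have gless: "g m < g n \<longleftrightarrow> m < n" for m n using f(1) fg by (metis strict_mono_less)
  have gle: "g m \<le> g n \<longleftrightarrow> m \<le> n" for m n using f(1) fg
    by (metis strict_mono_less_eq)
  have xE: "x * spec x l = spec x l * x" for l using spec_commutes[OF x] by simp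
  have up: "cpos (f l *\<^sub>R spec x l - fcalc f x * spec x l)" for l
  proof (cases "l < - norm x")
    case True then show ?thesis using spec_eq_0[OF x] by simp
  next
    case False
    let ?r = "spec x l"
    show ?thesis
    \<comment> \<open>f is approximated only on [- norm x, norm x], so the interval for this piece
      is clipped there.\<close>
    proof (rule cp(1)[of "- norm x" "min l (norm x)"])
      have "cpos ((norm x *\<^sub>R 1 + x) * ?r)"
        by (rule cpos_mult[OF cpos_norm_plus[OF x] cpos_projection[OF P]]) (simp add: algebra_simps xE)
      then show "cpos (x * ?r - (- norm x) *\<^sub>R ?r)" by (simp add: algebra_simps)
      have "cpos ((norm x *\<^sub>R 1 - x) * ?r)"
        by (rule cpos_mult[OF cpos_norm_minus[OF x] cpos_projection[OF P]]) (simp add: algebra_simps xE)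
      then show "cpos (min l (norm x) *\<^sub>R ?r - x * ?r)"
        using spec_upper[OF x, of l] by (simp add: min_def algebra_simps)
      show "f t \<le> f l" if "t \<le> min l (norm x)" for t using f(1) that
        by (simp add: strict_mono_less_eq)
    qed (use False P xE in auto)
  qed
  have lo: "cpos (fcalc f x * (1 - spec x l) - f l *\<^sub>R (1 - spec x l))" for l
  proof (cases "norm x < l")
    case True then show ?thesis using spec_eq_1[OF x] by simp
  next
    case False
    let ?r = "1 - spec x l"
    have xr: "x * ?r = ?r * x" using xE by (intro commute_intros)
    show ?thesis
    proof (rule cp(2)[of "max l (- norm x)" "norm x"])
      have "cpos ((norm x *\<^sub>R 1 + x) * ?r)"
        by (rule cpos_mult[OF cpos_norm_plus[OF x] cpos_projection[OF projection_compl[OF P]]])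
          (simp add: distrib_right distrib_left xr)
      then have "cpos (x * ?r - (- norm x) *\<^sub>R ?r)" by (simp add: distrib_right add.commute)
      then show "cpos (x * ?r - max l (- norm x) *\<^sub>R ?r)"
        using spec_lower[OF x, of l] by (simp add: max_def)
      have "cpos ((norm x *\<^sub>R 1 - x) * ?r)"
        by (rule cpos_mult[OF cpos_norm_minus[OF x] cpos_projection[OF projection_compl[OF P]]],
            intro commute_intros) (simp_all add: xE)
      then show "cpos (norm x *\<^sub>R ?r - x * ?r)"
        by (simp add: left_diff_distrib[of "_ *\<^sub>R 1"])
      show "f l \<le> f t" if "max l (- norm x) \<le> t" for t using f(1) that
        by (simp add: strict_mono_less_eq)
      show "?r \<in> projections" using P projection_compl by blast
    qed (use False xr in auto)
  qed
  have "is_spectral_family (fcalc f x) (\<lambda>m. spec x (g m))"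
    unfolding is_spectral_family_def
  proof (intro conjI allI impI)
    fix l
    have "{spec x (g m) |m. l < m} = {spec x k |k. g l < k}"
    proof (intro set_eqI iffI)
      fix y assume "y \<in> {spec x k |k. g l < k}"
      then obtain k where "y = spec x (g (f k))" "g l < g (f k)" by (auto simp: gf)
      then show "y \<in> {spec x (g m) |m. l < m}" using gless by blast
    qed (use gless in auto)
    then show "proj_glb {spec x (g m) |m. l < m} (spec x (g l))"
      using is_spectral_family_spec[OF x] unfolding is_spectral_family_def by simp
    show "loewner (fcalc f x * spec x (g l)) (l *\<^sub>R spec x (g l))"
      using up[of "g l"] by (simp add: loewner_iff_cpos fg)
    show "loewner (l *\<^sub>R (1 - spec x (g l))) (fcalc f x * (1 - spec x (g l)))"
      using lo[of "g l"] by (simp add: loewner_iff_cpos fg)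
  next
    obtain a where a: "\<forall>l< -a. spec x l = 0" "\<forall>l>a. spec x l = 1" using spec_bounded[OF x] by blast
    define b where "b = \<bar>f (-a)\<bar> + \<bar>f a\<bar> + 1"
    have "g l < - a" if "l < - b" for l
    proof -
      have "f (g l) < f (- a)" using that by (auto simp: fg b_def)
      then show ?thesis using f(1) by (simp add: strict_mono_less)
    qed
    moreover have "g l > a" if "l > b" for l
    proof -
      have "f a < f (g l)" using that by (auto simp: fg b_def)
      then show ?thesis using f(1) by (simp add: strict_mono_less)
    qed
    moreover have "b > 0" by (simp add: b_def)
    ultimately show "\<exists>a>0. (\<forall>l< -a. spec x (g l) = 0) \<and> (\<forall>l>a. spec x (g l) = 1)" using a by blast
  qed (use P spec_mono[OF x] gle in auto)
  then have "spec (fcalc f x) = (\<lambda>m. spec x (g m))" by (rule spec_eqI[OF sa])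
  then show "spec (fcalc f x) (f l) = spec x l" by (simp add: gf)
qed

end

section \<open>Atoms in type I factors\<close>

definition proj_atom :: "'a::cstar_algebra \<Rightarrow> bool" where
  "proj_atom u \<longleftrightarrow> u \<in> projections \<and> u \<noteq> 0 \<and> (\<forall>q\<in>projections. loewner q u \<longrightarrow> q = 0 \<or> q = u)"

lemma proj_atom_projection: "proj_atom u \<Longrightarrow> u \<in> projections"
  by (simp add: proj_atom_def)

context aw_star_algebra
begin

lemma loewner_compl_swap: "loewner x (1 - y) \<longleftrightarrow> loewner y (1 - (x::'a))"
  by (simp add: loewner_iff_cpos algebra_simps)

lemma projection_diff:
  assumes "(p::'a) \<in> projections" "q \<in> projections" "loewner p q" shows "q - p \<in> projections"
proof -
  have "p * q = p" "q * p = p" using assms loewner_projection_iff loewner_projection_iff' by blast+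
  then show ?thesis using assms(1,2) by (simp add: projections_def adj_simps algebra_simps)
qed

lemma loewner_disjoint:
  assumes "(u::'a) \<in> projections" "e \<in> projections" "loewner u e" "loewner u (1 - e)" shows "u = 0"
proof -
  have "u * e = u" "u * (1 - e) = u"
    using assms loewner_projection_iff projection_compl by blast+
  then show ?thesis by (simp add: algebra_simps)
qed

text \<open>Apply the hypothesis to the kernel projection of the idempotent \<open>p + p a (1 - p)\<close>.\<close>

lemma central_of_commuting_projections:
  assumes p: "(p::'a) \<in> projections" and com: "\<And>q. q \<in> projections \<Longrightarrow> q * p = p * q"
  shows "p * x = x * p"
proof -
  note P = projectionsD[OF p]
  have z0: "p * a * (1 - p) = 0" for a
  proof -
    define z where "z = p * a * (1 - p)"
    have zp: "z * p = 0" and pz: "p * z = z" using P by (simp_all add: z_def algebra_simps)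
       (simp add: P flip: mult.assoc)
    have zz: "z * z = 0" by (metis zp pz mult.assoc mult_zero_left)
    obtain g where g: "g \<in> projections" "\<And>y. (\<forall>s\<in>{p + z}. s * y = 0) \<longleftrightarrow> g * y = y"
      by (rule annihilator[of "{p + z}"]) auto
    have gy: "(p + z) * y = 0 \<longleftrightarrow> g * y = y" for y using g(2) by simp
    have "(p + z) * g = 0" using gy projectionsD(2)[OF g(1)] by blast
    then have 1: "p * g + z * g = 0" by (simp add: algebra_simps)
    have "(p + z) * g * p = (p + z) * p * g" using com[OF g(1)] by (simp add: mult.assoc)
    then have "p * g = 0" unfolding \<open>(p + z) * g = 0\<close> by (simp add: distrib_right P zp)
    then have zg: "z * g = 0" using 1 by simp
    have "(p + z) * (1 - p - z) = 0" by (simp add: algebra_simps P pz zp zz)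
    then have "g * (1 - p - z) = 1 - p - z" using gy by blast
    then have "z * (1 - p - z) = 0" by (metis zg mult.assoc mult_zero_left)
    then have "z = 0" by (simp add: right_diff_distrib zp zz)
    then show ?thesis by (simp only: z_def)
  qed
  have pap: "p * a = p * a * p" for a
    using z0[of a] by (simp only: right_diff_distrib mult_1_right right_minus_eq)
  have 1: "p * x = p * x * p" by (rule pap)
  have "p * adj x = p * adj x * p" by (rule pap)
  then have "adj (p * adj x) = adj (p * adj x * p)" by simp
  then have "x * p = p * x * p" by (simp add: adj_simps P mult.assoc)
  then show ?thesis using 1 by simp
qed

text \<open>An atom p meets each spectral projection of h in 0 or p, so there is a single jump, at
  c, and h is squeezed onto c p.\<close>

lemma corner_scalar:
  fixes h :: 'a
  assumes p: "proj_atom p" and h: "adj h = h" "h * p = h" "p * h = h"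
  shows "\<exists>c. h = c *\<^sub>R p"
proof -
  have pp: "p \<in> projections" "p \<noteq> 0" using p by (auto simp: proj_atom_def)
  note P = projectionsD[OF pp(1)]
  let ?E = "spec h"
  note Ep = spec_projection[OF h(1)]
  have pE: "p * ?E l = ?E l * p" for l by (rule spec_commutes[OF h(1)]) (simp add: h)
  have hE: "h * ?E l = ?E l * h" for l by (rule spec_commutes[OF h(1)]) simp
  have dich: "?E l * p = 0 \<or> ?E l * p = p" for l
  proof -
    have r: "?E l * p \<in> projections" using pE by (intro projection_mult Ep pp) simp
    moreover have "loewner (?E l * p) p" using loewner_projection_iff[OF r pp(1)] P
      by (simp add: mult.assoc)
    ultimately show ?thesis using p by (auto simp: proj_atom_def)
  qed
  define S where "S = {l. ?E l * p = p}"
  have "norm h + 1 \<in> S" using spec_eq_1[OF h(1), of "norm h + 1"] by (simp add: S_def)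
  then have Sne: "S \<noteq> {}" by blast
  have Sb: "- norm h \<le> l" if "l \<in> S" for l
    using that pp(2) spec_eq_0[OF h(1), of l] by (auto simp: S_def not_less[symmetric])
  then have bdd: "bdd_below S" by (auto simp: bdd_below_def)
  define c where "c = Inf S"
  have up: "cpos (l *\<^sub>R p - h)" if lc: "l > c" for l
  proof -
    obtain s where s: "s \<in> S" "s < l" using lc cInf_less_iff[OF Sne bdd, of l] unfolding c_def by blast
    have "?E l * ?E s = ?E s"
      using spec_mono[OF h(1), of s l] s loewner_projection_iff'[OF Ep Ep] by simp
    moreover have Es: "?E s * p = p" using s by (simp add: S_def)
    ultimately have El: "?E l * p = p" by (metis mult.assoc)
    have "cpos ((l *\<^sub>R ?E l - h * ?E l) * p)"
      by (rule cpos_mult[OF spec_upper[OF h(1)] cpos_projection[OF pp(1)]], intro commute_intros)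
        (simp_all add: h pE)
    then show ?thesis by (simp add: left_diff_distrib mult.assoc El h)
  qed
  have lo: "cpos (h - l *\<^sub>R p)" if "l < c" for l
  proof -
    have "l \<notin> S" using that cInf_lower[OF _ bdd] by (force simp: c_def)
    then have El: "?E l * p = 0" using dich by (auto simp: S_def)
    have "cpos ((h * (1 - ?E l) - l *\<^sub>R (1 - ?E l)) * p)"
      by (rule cpos_mult[OF spec_lower[OF h(1)] cpos_projection[OF pp(1)]], intro commute_intros)
        (simp_all add: h pE)
    then show ?thesis by (simp add: left_diff_distrib right_diff_distrib mult.assoc El h)
  qed
  have 1: "cpos (c *\<^sub>R p - h)"
  proof (rule cpos_of_eps[where y=p])
    show "cpos (c *\<^sub>R p - h + e *\<^sub>R p)" if "e > 0" for e using up[of "c + e"] that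
      by (simp add: algebra_simps)
  qed
  have "cpos (h - c *\<^sub>R p)"
  proof (rule cpos_of_eps[where y=p])
    show "cpos (h - c *\<^sub>R p + e *\<^sub>R p)" if "e > 0" for e using lo[of "c - e"] that
      by (simp add: algebra_simps)
  qed
  then have "c *\<^sub>R p - h = 0" using 1 by (intro cpos_antisym) auto
  then show ?thesis by (intro exI[of _ c]) simp
qed

end

section \<open>Atomicity of the projection lattice of a type I factor\<close>

locale type_I_factor = aw_star_algebra T for T :: "'a::cstar_algebra itself" +
  assumes center: "(center :: 'a set) = range (\<lambda>c. scaleC c 1)" and typeI: "type_I T"
begin

lemma central_projection:
  assumes p: "(p::'a) \<in> projections" and com: "\<And>x. p * x = x * p" shows "p = 0 \<or> p = 1"
proof -
  have "p \<in> center" using com by (simp add: center_def)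
  then obtain c where c: "p = scaleC c 1" using center by auto
  have "scaleC (c * c) 1 = scaleC c (1::'a)"
    using projectionsD(2)[OF p] by (simp add: c scaleC_mult_left scaleC_scaleC)
  then have "scaleC (c * c - c) (1::'a) = 0"
    using scaleC_add_left[of "c * c - c" c "1::'a"] by simp
  then have "cmod (c * c - c) = 0" using norm_scaleC[of "c * c - c" "1::'a"] by simp
  then have "c * (c - 1) = 0" by (simp add: algebra_simps)
  then have "c = 0 \<or> c = 1" by auto
  then show ?thesis using scaleC_of_real[of 0 "1::'a"] by (auto simp: c scaleC_one)
qed

text \<open>The right annihilator of all q x is stable under left multiplication, so its projection
  is central, hence 0 or 1. The value 1 would give q = 0, the value 0 would give p = 0.\<close>

lemma factor_mult_nonzero:
  assumes "(q::'a) \<noteq> 0" "p \<noteq> 0" shows "\<exists>x. q * x * p \<noteq> 0"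
proof (rule ccontr)
  assume "\<not> ?thesis"
  then have 0: "q * x * p = 0" for x by blast
  obtain e where e: "e \<in> projections" "\<And>y. (\<forall>s\<in>range ((*) q). s * y = 0) \<longleftrightarrow> e * y = y"
    by (rule annihilator[of "range ((*) q)"]) auto
  have ey: "(\<forall>x. q * x * y = 0) \<longleftrightarrow> e * y = y" for y using e(2) by simp
  have ex: "e * (x * e) = x * e" for x
  proof -
    have "\<forall>x. q * x * e = 0" using ey projectionsD(2)[OF e(1)] by blast
    then have "\<forall>x'. q * x' * (x * e) = 0" by (metis mult.assoc)
    then show ?thesis using ey by blast
  qed
  have "e * x = x * e" for x
  proof -
    have "adj (e * (adj x * e)) = adj (adj x * e)" using ex by simp
    then have "e * x * e = e * x" by (simp add: adj_simps projectionsD(1)[OF e(1)])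
    then show ?thesis using ex[of x] by (simp add: mult.assoc)
  qed
  then consider "e = 0" | "e = 1" using central_projection[OF e(1)] by blast
  then show False
  proof cases
    case 1
    then show ?thesis using ey[of p] 0 assms by simp
  next
    case 2
    then have "\<forall>x. q * x * 1 = 0" using ey[of 1] by simp
    then have "q * 1 * 1 = 0" by blast
    then show ?thesis using assms by simp
  qed
qed

text \<open>A faithful abelian projection p is nonzero, and it is an atom: for 0 < q < p some w = q
  x (p - q) is nonzero, and in the commutative corner w = q w = w q = 0.\<close>

lemma ex_proj_atom: "\<exists>p::'a. proj_atom p"
proof -
  obtain p :: 'a where p: "abelian_projection p" "\<forall>z\<in>projections \<inter> center. loewner p z \<longrightarrow> z = 1"
    using typeI unfolding type_I_def by blast
  have pp: "p \<in> projections" using p by (simp add: abelian_projection_def)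
  have ab: "(p * x * p) * (p * y * p) = (p * y * p) * (p * x * p)" for x y
    using p by (simp add: abelian_projection_def)
  have "p \<noteq> 0"
  proof
    assume "p = 0"
    then have "(0::'a) = 1" using p(2) by (auto simp: center_def dest: bspec[of _ _ 0])
    then show False by simp
  qed
  moreover have "q = 0 \<or> q = p" if q: "q \<in> projections" "loewner q p" for q
  proof (rule ccontr)
    assume "\<not> ?thesis"
    then obtain x where x: "q * x * (p - q) \<noteq> 0" using factor_mult_nonzero[of q "p - q"] by auto
    define r where "r = p - q"
    have r: "r \<in> projections" unfolding r_def by (rule projection_diff[OF q(1) pp q(2)])
    have qp: "q * p = q" "p * q = q"
      using q pp loewner_projection_iff loewner_projection_iff' by blast+
    have Q: "q * q = q" "p * p = p" using q pp projectionsD by blast+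
    have rp: "r * p = r" and rq: "r * q = 0" by (simp_all add: r_def algebra_simps qp Q)
    let ?w = "q * x * r"
    have w: "p * ?w * p = ?w" by (simp add: mult.assoc rp) (simp add: qp flip: mult.assoc)
    have pqp: "p * q * p = q" by (simp add: qp)
    have "q * ?w = ?w * q" using ab[of q ?w] unfolding w pqp .
    then have "?w = 0" using rq Q by (metis mult.assoc mult_zero_right)
    then show False using x by (simp add: r_def)
  qed
  ultimately show ?thesis using pp unfolding proj_atom_def by blast
qed

text \<open>An atom p is moved into q by a partial isometry. For b = q x p the element
  \<open>adj b * b\<close> is c p with c > 0 by \<open>corner_scalar\<close>, and v = b / sqrt c has
  initial projection p and final projection below q.\<close>

lemma proj_atom_below:
  assumes q: "(q::'a) \<in> projections" "q \<noteq> 0"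
  shows "\<exists>u. proj_atom u \<and> loewner u q"
proof -
  obtain p :: 'a where p: "proj_atom p" using ex_proj_atom by blast
  then have pp: "p \<in> projections" "p \<noteq> 0" by (auto simp: proj_atom_def)
  note P = projectionsD[OF pp(1)] and Q = projectionsD[OF q(1)]
  obtain x where x: "q * x * p \<noteq> 0" using factor_mult_nonzero[OF q(2) pp(2)] by blast
  define b where "b = q * x * p"
  have bp: "b * p = b" and qb: "q * b = b" using P Q
    by (simp_all add: b_def mult.assoc) (simp add: Q flip: mult.assoc)
  have pb: "p * adj b = adj b" using bp by (metis adj_mult P(1))
  obtain c where c: "adj b * b = c *\<^sub>R p"
  proof -
    have "p * (adj b * b) = adj b * b" by (simp add: pb flip: mult.assoc)
    then show thesis using corner_scalar[OF p, of "adj b * b"] bp that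
      by (auto simp: adj_simps mult.assoc)
  qed
  have "c > 0"
  proof (rule ccontr)
    assume "\<not> c > 0"
    then have "cpos (- (adj b * b))"
      using cpos_scaleR[OF cpos_projection[OF pp(1)], of "- c"] by (simp add: c)
    then show False using cpos_neg_adj_mult x b_def by blast
  qed
  define v where "v = (1 / sqrt c) *\<^sub>R b"
  have vv: "adj v * v = p" using \<open>c > 0\<close> by (simp add: v_def adj_simps c)
  have vp: "v * p = v" "q * v = v" by (simp_all add: v_def bp qb)
  have pv: "p * adj v = adj v" using vp by (metis adj_mult P(1))
  define w where "w = v * adj v"
  have ww: "w * w = w"
  proof -
    have "w * w = v * (adj v * v) * adj v" by (simp add: w_def mult.assoc)
    then show ?thesis by (simp add: vv vp w_def)
  qed
  have w: "w \<in> projections" using ww by (simp add: projections_def) (simp add: w_def adj_simps)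
  have wv: "w * v = v" by (simp add: w_def mult.assoc vv vp)
  have "w \<noteq> 0" using wv pp vv by auto
  moreover have "r = 0 \<or> r = w" if r: "r \<in> projections" "loewner r w" for r
  proof -
    note R = projectionsD[OF r(1)]
    have rw: "r * w = r" "w * r = r" using r w loewner_projection_iff loewner_projection_iff' by blast+
    \<comment> \<open>Conjugation by v carries projections below w to projections below p, and there
      the atom p decides.\<close>
    define s where "s = adj v * r * v"
    have "s * s = adj v * (r * w * r) * v" by (simp add: s_def w_def mult.assoc)
    then have s: "s \<in> projections" by (simp add: projections_def rw R s_def adj_simps mult.assoc)
    have "loewner s p" using loewner_projection_iff[OF s pp(1)] by (simp add: s_def mult.assoc vp)
    then consider "s = 0" | "s = p" using p s by (auto simp: proj_atom_def)
    then show ?thesis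
    proof cases
      case 1
      have "adj (r * v) * (r * v) = adj v * (r * r) * v" by (simp add: adj_simps R(1) mult.assoc)
      then have "adj (r * v) * (r * v) = 0" using 1 by (simp add: R s_def)
      then have "r * v = 0" using adj_mult_self_eq_0_iff by blast
      then have "r * w = 0" by (simp add: w_def flip: mult.assoc)
      then show ?thesis using rw by simp
    next
      case 2
      have "w * r * w = v * s * adj v" by (simp add: w_def s_def mult.assoc)
      then have "r = w" using rw 2 by (simp add: vp w_def)
      then show ?thesis by simp
    qed
  qed
  moreover have "loewner w q" using loewner_projection_iff'[OF w q(1)]
    by (simp add: w_def vp flip: mult.assoc)
  ultimately show ?thesis using w unfolding proj_atom_def by blast
qed

text \<open>If 1 - q exceeded its meet with 1 - p, the difference would contain an atom below 1 - q
  but not below 1 - p. The form with 1 - u fits the steps over coatoms.\<close>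

lemma projection_le_by_atoms:
  assumes p: "(p::'a) \<in> projections" and q: "q \<in> projections"
    and le: "\<And>u. proj_atom u \<Longrightarrow> loewner q (1 - u) \<Longrightarrow> loewner p (1 - u)"
  shows "loewner p q"
proof -
  define r where "r = 1 - q"
  define s where "s = 1 - p"
  have rs: "r \<in> projections" "s \<in> projections" using p q projection_compl
    by (auto simp: r_def s_def)
  obtain e where e: "proj_glb {r, s} e" using projection_glb[of "{r, s}"] rs by auto
  have ep: "e \<in> projections" "loewner e r" "loewner e s" using e by (auto simp: proj_glb_def)
  have d: "r - e \<in> projections" by (rule projection_diff[OF ep(1) rs(1) ep(2)])
  have "r - e = 0"
  proof (rule ccontr)
    assume "r - e \<noteq> 0"
    then obtain u where u: "proj_atom u" "loewner u (r - e)" using proj_atom_below d by blast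
    have up: "u \<in> projections" "u \<noteq> 0" using u by (auto simp: proj_atom_def)
    have "loewner (r - e) r" using ep(1) by (simp add: loewner_iff_cpos cpos_projection)
    then have ur: "loewner u r" using u loewner_trans by blast
    then have "loewner q (1 - u)" by (simp add: r_def loewner_compl_swap[of q])
    then have "loewner p (1 - u)" using le u by blast
    then have "loewner u s" by (simp add: s_def loewner_compl_swap[of p])
    then have "loewner u e" using e ur up by (simp add: proj_glb_def)
    moreover have "loewner (r - e) (1 - e)" using rs(1)
      by (simp add: loewner_iff_cpos cpos_projection projection_compl)
    then have "loewner u (1 - e)" using u loewner_trans by blast
    ultimately show False using loewner_disjoint up ep(1) by blast
  qed
  then have "loewner r s" using ep by simp
  then show ?thesis by (simp add: r_def s_def loewner_compl_iff)
qed

end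

section \<open>Order characterisation of scalars and of atomic steps\<close>

lemma sa_iff: "x \<in> sa_part \<longleftrightarrow> adj x = x"
  by (simp add: sa_part_def)

lemma step_sa: "p \<in> projections \<Longrightarrow> step a b p \<in> sa_part"
  by (simp add: sa_iff adj_step)

lemma scalar_sa: "c *\<^sub>R 1 \<in> sa_part"
  by (simp add: sa_iff adj_scaleR)

text \<open>Joins and meets are replaced by their sets of upper and lower bounds: \<open>neutral x\<close> says that
  \<open>(x \<squnion> y) \<sqinter> (x \<squnion> z) \<le> x\<close> whenever \<open>y \<sqinter> z \<le> x\<close>.\<close>

definition neutral :: "'a::cstar_algebra \<Rightarrow> bool" where
  "neutral x \<longleftrightarrow> (\<forall>y\<in>sa_part. \<forall>z\<in>sa_part. \<forall>v\<in>sa_part.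
     (\<forall>s\<in>sa_part. spectral_le x s \<and> spectral_le y s \<longrightarrow> spectral_le v s) \<and>
     (\<forall>s\<in>sa_part. spectral_le x s \<and> spectral_le z s \<longrightarrow> spectral_le v s) \<and>
     (\<forall>r\<in>sa_part. spectral_le r y \<and> spectral_le r z \<longrightarrow> spectral_le r x) \<longrightarrow> spectral_le v x)"

definition chain_between :: "'a::cstar_algebra \<Rightarrow> 'a \<Rightarrow> bool" where
  "chain_between a x \<longleftrightarrow> (\<forall>y\<in>sa_part. \<forall>z\<in>sa_part.
     spectral_le a y \<and> spectral_le y x \<and> spectral_le a z \<and> spectral_le z x \<longrightarrow>
     spectral_le y z \<or> spectral_le z y)"

section \<open>Order tests with scalars and steps\<close>

context aw_star_algebra
begin

lemma spec_scalar: "spec (c *\<^sub>R (1::'a)) = (\<lambda>l. if l < c then 0 else 1)"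
  using spec_step[OF projection_1, of c c] by (simp add: step_def fun_eq_iff)

lemma spectral_le_trans: "spectral_le x y \<Longrightarrow> spectral_le y z \<Longrightarrow> spectral_le x (z::'a)"
  unfolding spectral_le_def using loewner_trans by blast

lemma projection_eq_0_iff: "p \<in> projections \<Longrightarrow> loewner p 0 \<longleftrightarrow> p = (0::'a)"
  and projection_eq_1_iff: "p \<in> projections \<Longrightarrow> loewner 1 p \<longleftrightarrow> p = (1::'a)"
  using loewner_antisym zero_loewner_projection projection_loewner_one loewner_refl by blast+

lemma scalar_spectral_le_iff:
  assumes "x \<in> sa_part" shows "spectral_le (c *\<^sub>R (1::'a)) x \<longleftrightarrow> (\<forall>l<c. spec x l = 0)"
proof -
  have P: "spec x l \<in> projections" for l using assms spec_projection by (simp add: sa_iff)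
  show ?thesis unfolding spectral_le_def spec_scalar
    using P projection_eq_0_iff[OF P] projection_loewner_one[OF P] by auto
qed

lemma spectral_le_scalar_iff:
  assumes "x \<in> sa_part" shows "spectral_le x (c *\<^sub>R (1::'a)) \<longleftrightarrow> (\<forall>l\<ge>c. spec x l = 1)"
proof -
  have P: "spec x l \<in> projections" for l using assms spec_projection by (simp add: sa_iff)
  show ?thesis unfolding spectral_le_def spec_scalar
    using P projection_eq_1_iff[OF P] zero_loewner_projection[OF P] by (auto simp: not_less)
qed

lemma spec_eq_1_mono:
  assumes "x \<in> sa_part" "spec x l = (1::'a)" "l \<le> m" shows "spec x m = 1"
  using assms spec_mono[of x l m] projection_eq_1_iff spec_projection by (simp add: sa_iff)

lemma spec_eq_1_right:
  assumes "x \<in> sa_part" "\<And>m. l < m \<Longrightarrow> spec x m = (1::'a)" shows "spec x l = 1"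
  using assms spec_rightI[of x 1 l] projection_eq_1_iff spec_projection by (simp add: sa_iff)

lemma scalar_le_scalar_iff: "spectral_le (a *\<^sub>R (1::'a)) (b *\<^sub>R 1) \<longleftrightarrow> a \<le> b"
  unfolding scalar_spectral_le_iff[OF scalar_sa] spec_scalar by (auto simp: not_less)

lemma scalar_below:
  assumes "x \<in> sa_part" "c \<le> - norm x" shows "spectral_le (c *\<^sub>R (1::'a)) x"
  using assms spec_eq_0[of x] by (simp add: scalar_spectral_le_iff sa_iff)

text \<open>Given the lower bound a, only the values of the step on [a, b) restrict x. Stating the
  condition for all l < b removes a from it.\<close>

lemma step_le_iff:
  assumes p: "(p::'a) \<in> projections" and ab: "a \<le> b" and x: "x \<in> sa_part" "spectral_le (a *\<^sub>R 1) x"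
  shows "spectral_le (step a b p) x \<longleftrightarrow> (\<forall>l<b. loewner (spec x l) p)"
proof -
  have P: "spec x l \<in> projections" for l using x spec_projection by (simp add: sa_iff)
  have 0: "spec x l = 0" if "l < a" for l using x that by (simp add: scalar_spectral_le_iff)
  show ?thesis
  proof
    assume le: "spectral_le (step a b p) x"
    show "\<forall>l<b. loewner (spec x l) p"
    proof (intro allI impI)
      fix l assume "l < b"
      then show "loewner (spec x l) p"
        using le[unfolded spectral_le_def, rule_format, of l] 0[of l] zero_loewner_projection[OF p]
        by (auto simp: spec_step[OF p ab] split: if_splits)
    qed
  next
    assume "\<forall>l<b. loewner (spec x l) p"
    then show "spectral_le (step a b p) x"
      using 0 projection_loewner_one[OF P] by (auto simp: spectral_le_def spec_step[OF p ab])
  qed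
qed

lemma scalar_le_step: "(p::'a) \<in> projections \<Longrightarrow> c \<le> a \<Longrightarrow> a \<le> b \<Longrightarrow> spectral_le (c *\<^sub>R 1) (step a b p)"
  by (simp add: scalar_spectral_le_iff step_sa spec_step)

lemma step_le_scalar: "(p::'a) \<in> projections \<Longrightarrow> a \<le> b \<Longrightarrow> b \<le> c \<Longrightarrow> spectral_le (step a b p) (c *\<^sub>R 1)"
  by (simp add: spectral_le_scalar_iff step_sa spec_step)

lemma le_step_spec:
  assumes y: "(y::'a) \<in> sa_part" and b: "norm y < b" and m: "m < b"
  shows "spectral_le y (step m b (spec y m))"
proof -
  have ya: "adj y = y" using y by (simp add: sa_iff)
  show ?thesis
    unfolding spectral_le_def spec_step[OF spec_projection[OF ya] less_imp_le[OF m]]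
    using zero_loewner_projection[OF spec_projection[OF ya]] spec_mono[OF ya] spec_eq_1[OF ya] b
    by auto
qed

lemma neutral_scalar: "neutral (c *\<^sub>R (1::'a))"
  unfolding neutral_def
proof (intro ballI impI, elim conjE)
  fix y z v :: 'a
  assume sa: "y \<in> sa_part" "z \<in> sa_part" "v \<in> sa_part"
    and hy: "\<forall>s\<in>sa_part. spectral_le (c *\<^sub>R 1) s \<and> spectral_le y s \<longrightarrow> spectral_le v s"
    and hz: "\<forall>s\<in>sa_part. spectral_le (c *\<^sub>R 1) s \<and> spectral_le z s \<longrightarrow> spectral_le v s"
    and hr: "\<forall>r\<in>sa_part. spectral_le r y \<and> spectral_le r z \<longrightarrow> spectral_le r (c *\<^sub>R 1)"
  have P: "spec x l \<in> projections" if "x \<in> sa_part" for x :: 'a and l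
    using that spec_projection by (simp add: sa_iff)
  \<comment> \<open>A step that keeps only the spectral projection of w at m > c lies above both c
    and w, hence above v.\<close>
  have above: "loewner (spec w m) (spec v m)"
    if w: "w \<in> sa_part" and hw: "\<forall>s\<in>sa_part. spectral_le (c *\<^sub>R 1) s \<and> spectral_le w s \<longrightarrow> spectral_le v s"
      and m: "c < m" for w m
  proof -
    define b where "b = max m (norm w) + 1"
    have b: "m < b" "norm w < b" by (auto simp: b_def)
    let ?s = "step m b (spec w m)"
    have "spectral_le (c *\<^sub>R 1) ?s" using m b by (intro scalar_le_step P w) auto
    then have "spectral_le v ?s" using hw le_step_spec[OF w b(2,1)] step_sa[OF P[OF w]] by blast
    then have "loewner (spec ?s m) (spec v m)" by (simp add: spectral_le_def)
    then show ?thesis using b by (simp add: spec_step[OF P[OF w]])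
  qed
  have v1: "spec v m = 1" if m: "c < m" for m
  proof -
    define d where "d = min (min (- norm y) (- norm z)) c"
    have d: "d \<le> - norm y" "d \<le> - norm z" "d \<le> c" by (auto simp: d_def)
    \<comment> \<open>This step lies below y and z, hence below c. As c lies in [d, m), its spectral
      projection at c is that of v at m, which must therefore be 1.\<close>
    let ?r = "step d m (spec v m)"
    have below: "spectral_le ?r w"
      if w: "w \<in> sa_part" "d \<le> - norm w" and le: "loewner (spec w m) (spec v m)" for w
    proof -
      have wa: "adj w = w" using w by (simp add: sa_iff)
      have "loewner (spec w l) (spec v m)" if "l < m" for l
        using loewner_trans[OF spec_mono[OF wa, of l m] le] that by simp
      then show ?thesis using m d step_le_iff[OF P[OF sa(3)], of d m w] scalar_below[OF w] w by auto
    qed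
    have "spectral_le ?r (c *\<^sub>R 1)"
      using hr step_sa[OF P[OF sa(3)]] below[OF sa(1) d(1) above[OF sa(1) hy m]]
        below[OF sa(2) d(2) above[OF sa(2) hz m]] by blast
    then have "spec ?r c = 1" by (simp add: spectral_le_scalar_iff step_sa P sa)
    then show ?thesis using m d by (simp add: spec_step[OF P[OF sa(3)]])
  qed
  have "spec v c = 1" by (rule spec_eq_1_right[OF sa(3) v1])
  then show "spectral_le v (c *\<^sub>R 1)"
    using spec_eq_1_mono[OF sa(3)] by (simp add: spectral_le_scalar_iff sa)
qed

text \<open>Neutrality is applied to steps over q and 1 - q, whose common lower bounds all lie below
  a scalar under x. For each m > l it yields w commuting with q and lying between the spectral
  projections of x at l and m; the meet of these w is the one at l.\<close>

lemma spec_commutes_of_neutral: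
  assumes x: "x \<in> sa_part" and neu: "neutral x" and q: "(q::'a) \<in> projections"
  shows "q * spec x l = spec x l * q"
proof -
  have xa: "adj x = x" using x by (simp add: sa_iff)
  note P = spec_projection[OF xa]
  have q': "1 - q \<in> projections" using q projection_compl by blast
  have "\<exists>w\<in>projections. q * w = w * q \<and> loewner w (spec x m) \<and> loewner (spec x l) w" if m: "l < m" for m
  proof -
    obtain e where e: "proj_glb {spec x m, q} e"
      by (rule projection_glb[of "{spec x m, q}"]) (use P q in auto)
    obtain f where f: "proj_glb {spec x m, 1 - q} f"
      by (rule projection_glb[of "{spec x m, 1 - q}"]) (use P q' in auto)
    have e': "e \<in> projections" "loewner e (spec x m)" "loewner e q"
      and f': "f \<in> projections" "loewner f (spec x m)" "loewner f (1 - q)"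
      using e f by (auto simp: proj_glb_def)
    have qe: "q * e = e" "e * q = e" and qf: "(1 - q) * f = f" "f * (1 - q) = f"
      and em: "spec x m * e = e" "e * spec x m = e" and fm: "spec x m * f = f" "f * spec x m = f"
      using loewner_projection_iff loewner_projection_iff' e' f' q q' P by blast+
    have qf0: "q * f = 0" "f * q = 0" using qf by (simp_all add: algebra_simps)
    have ef: "e * f = 0" "f * e = 0" by (metis qe(2) qf0(1) mult.assoc mult_zero_right)
        (metis qe(1) qf0(2) mult.assoc mult_zero_left)
    \<comment> \<open>The join of the meets of \<open>spec x m\<close> with q and with 1 - q; it
      equals \<open>spec x m\<close> exactly when that commutes with q.\<close>
    define w where "w = e + f"
    have w: "w \<in> projections"
      using e'(1) f'(1) by (simp add: projections_def w_def adj_simps algebra_simps ef)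
    have qw: "q * w = w * q" by (simp add: w_def algebra_simps qe qf0)
    have wm: "loewner w (spec x m)"
      using loewner_projection_iff[OF w P] by (simp add: w_def algebra_simps em fm)
    have ew: "loewner e w" "loewner f w"
      using e' f' by (simp_all add: w_def loewner_iff_cpos cpos_projection)
    define a where "a = min (- norm x) l"
    define b where "b = max (norm x) m"
    have ab: "a \<le> - norm x" "a \<le> l" "m \<le> b" "a < b" using m by (auto simp: a_def b_def)
    have ax: "spectral_le (a *\<^sub>R 1) x" using scalar_below[OF x ab(1)] .
    let ?y = "step a b q" and ?z = "step a b (1 - q)" and ?v = "step a m w"
    have join: "spectral_le ?v s"
      if s: "s \<in> sa_part" "spectral_le x s" "spectral_le (step a b r) s" and r: "r \<in> projections"
        and g: "proj_glb {spec x m, r} g" "loewner g w" for s r g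
    proof -
      have as: "spectral_le (a *\<^sub>R 1) s" using ax s spectral_le_trans by blast
      have sp: "spec s k \<in> projections" for k using s(1) spec_projection by (simp add: sa_iff)
      have "loewner (spec s k) w" if "k < m" for k
      proof -
        have "loewner (spec s k) (spec x k)" using s(2) by (simp add: spectral_le_def)
        then have 1: "loewner (spec s k) (spec x m)"
          using spec_mono[OF xa, of k m] that loewner_trans by (meson less_imp_le)
        have "loewner (spec s k) r"
          using step_le_iff[OF r less_imp_le[OF ab(4)] s(1) as] s(3) that ab(3) by auto
        then have "loewner (spec s k) g" using g(1) 1 sp by (simp add: proj_glb_def)
        then show ?thesis using g(2) loewner_trans by blast
      qed
      moreover have "a \<le> m" using ab m by simp
      ultimately show ?thesis using step_le_iff[OF w _ s(1) as] by blast
    qed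
    have meet: "spectral_le r x" if r: "r \<in> sa_part" "spectral_le r ?y" "spectral_le r ?z" for r
    proof -
      have ra: "adj r = r" using r by (simp add: sa_iff)
      note R = spec_projection[OF ra]
      have "loewner q (spec r a)" "loewner (1 - q) (spec r a)"
        using r(2,3)[unfolded spectral_le_def, rule_format, of a] ab(4)
        by (simp_all add: spec_step q q')
      then have "spec r a * q = q" "spec r a * (1 - q) = 1 - q"
        using loewner_projection_iff' q q' R by blast+
      then have "spec r a = 1" by (simp add: algebra_simps)
      then have "spectral_le r (a *\<^sub>R 1)"
        using spec_eq_1_mono[OF r(1)] by (simp add: spectral_le_scalar_iff r(1))
      then show ?thesis using ax spectral_le_trans by blast
    qed
    have "spectral_le ?v x"
      by (rule neu[unfolded neutral_def, rule_format, of ?y ?z ?v])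
        (use join[OF _ _ _ q e ew(1)] join[OF _ _ _ q' f ew(2)] meet step_sa q q' w in blast)+
    then have "loewner (spec x l) w"
      using step_le_iff[OF w _ x ax, of m] m ab by auto
    then show ?thesis using w qw wm by blast
  qed
  then obtain W where W: "\<And>m. l < m \<Longrightarrow> W m \<in> projections" "\<And>m. l < m \<Longrightarrow> q * W m = W m * q"
    "\<And>m. l < m \<Longrightarrow> loewner (W m) (spec x m)" "\<And>m. l < m \<Longrightarrow> loewner (spec x l) (W m)" by metis
  let ?A = "W ` {l<..}"
  obtain e where e: "proj_glb ?A e" "\<And>z. (\<And>a. a \<in> ?A \<Longrightarrow> z * a = a * z) \<Longrightarrow> z * e = e * z"
    by (rule projection_glb[of ?A]) (use W(1) in auto)
  have ep: "e \<in> projections" using e by (simp add: proj_glb_def)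
  have "loewner (spec x l) e" using e(1) W(4) P by (auto simp: proj_glb_def)
  moreover have "loewner e (spec x l)"
  proof (rule spec_rightI[OF xa ep])
    fix m assume m: "l < m"
    then have "loewner e (W m)" using e(1) by (auto simp: proj_glb_def)
    then show "loewner e (spec x m)" using W(3)[OF m] loewner_trans by blast
  qed
  ultimately have "e = spec x l" using loewner_antisym by blast
  moreover have "q * e = e * q" using W(2) by (intro e(2)) auto
  ultimately show ?thesis by simp
qed

text \<open>The values at a and b are left open because right continuity determines them.\<close>

lemma spec_eq_stepI:
  assumes x: "(x::'a) \<in> sa_part" and p: "p \<in> projections" and ab: "a < b"
    and 0: "\<And>l. l < a \<Longrightarrow> spec x l = 0" and 1: "\<And>l. a < l \<Longrightarrow> l < b \<Longrightarrow> spec x l = p"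
    and 2: "\<And>l. b < l \<Longrightarrow> spec x l = 1"
  shows "x = step a b p"
proof (rule spec_inj)
  show xa: "adj x = x" using x by (simp add: sa_iff)
  show "adj (step a b p) = step a b p" by (rule adj_step[OF p])
  note P = spec_projection[OF xa]
  have b1: "spec x b = 1" by (rule spec_eq_1_right[OF x 2])
  have "loewner (spec x a) p"
    using spec_mono[OF xa, of a "(a + b) / 2"] 1[of "(a + b) / 2"] ab by simp
  moreover have "loewner p (spec x a)"
  proof (rule spec_rightI[OF xa p])
    fix m assume "a < m"
    then show "loewner p (spec x m)"
      using 1[of m] 2[of m] b1 projection_loewner_one[OF p] by (cases m b rule: linorder_cases) auto
  qed
  ultimately have "spec x a = p" by (rule loewner_antisym)
  then show "spec x = spec (step a b p)"
    unfolding spec_step[OF p less_imp_le[OF ab]] using 0 1 2 b1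
    by (intro ext) (metis linorder_less_linear order.strict_implies_order)
qed

text \<open>On [a, b) an element of the interval takes only the values 1 - u and 1, so two elements
  can differ only in where they reach 1.\<close>

lemma step_atom_chain:
  assumes u: "proj_atom (u::'a)" and ab: "a < b"
  shows "chain_between (a *\<^sub>R 1) (step a b (1 - u))"
  unfolding chain_between_def
proof (intro ballI impI, elim conjE)
  have up: "u \<in> projections" "1 - u \<in> projections" using u proj_atom_projection projection_compl by blast+
  have coatom: "q = 1 - u \<or> q = 1" if q: "q \<in> projections" "loewner (1 - u) q" for q
  proof -
    have "loewner (1 - q) u" using q loewner_compl_iff[of q "1 - u"] by simp
    then have "1 - q = 0 \<or> 1 - q = u" using u projection_compl[OF q(1)] unfolding proj_atom_def by blast
    then show ?thesis by auto
  qed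
  fix y z :: 'a
  assume y: "y \<in> sa_part" "spectral_le (a *\<^sub>R 1) y" "spectral_le y (step a b (1 - u))"
    and z: "z \<in> sa_part" "spectral_le (a *\<^sub>R 1) z" "spectral_le z (step a b (1 - u))"
  have val: "spec w l = (if l < a then 0 else if l < b then spec w l else 1)"
      "a \<le> l \<Longrightarrow> l < b \<Longrightarrow> spec w l = 1 - u \<or> spec w l = 1"
    if w: "w \<in> sa_part" "spectral_le (a *\<^sub>R 1) w" "spectral_le w (step a b (1 - u))" for w l
  proof -
    have wp: "spec w l \<in> projections" using w spec_projection by (simp add: sa_iff)
    have *: "loewner (if l < a then 0 else if l < b then 1 - u else 1) (spec w l)"
      using w(3)[unfolded spectral_le_def, rule_format, of l] ab by (simp add: spec_step[OF up(2)])
    show "spec w l = (if l < a then 0 else if l < b then spec w l else 1)"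
      using w(1,2) * ab projection_eq_1_iff[OF wp] by (auto simp: scalar_spectral_le_iff)
    show "a \<le> l \<Longrightarrow> l < b \<Longrightarrow> spec w l = 1 - u \<or> spec w l = 1" using * coatom[OF wp] by simp
  qed
  have ya: "adj y = y" and za: "adj z = z" using y z by (simp_all add: sa_iff)
  show "spectral_le y z \<or> spectral_le z y"
  proof (rule disjCI)
    assume "\<not> spectral_le z y"
    then obtain l where l: "\<not> loewner (spec y l) (spec z l)" by (auto simp: spectral_le_def)
    have al: "a \<le> l" "l < b" using l val(1)[OF y, of l] val(1)[OF z, of l] by (auto split: if_splits)
    have zl: "spec z l = 1 - u" and yl: "spec y l = 1"
      using l val(2)[OF y al] val(2)[OF z al] projection_loewner_one up(2) by auto
    have "loewner (spec z m) (spec y m)" for m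
    proof (cases "l \<le> m")
      case True
      then show ?thesis using spec_eq_1_mono[OF y(1) yl] projection_loewner_one[OF spec_projection[OF za]] by simp
    next
      case False
      show ?thesis
      proof (cases "m < a")
        case True
        then show ?thesis using val(1)[OF z, of m] zero_loewner_projection[OF spec_projection[OF ya]] by simp
      next
        case am: False
        have "loewner (spec z m) (1 - u)" using spec_mono[OF za, of m l] False zl by simp
        then show ?thesis using val(2)[OF y, of m] am False al
            projection_loewner_one[OF spec_projection[OF za], of m] by auto
      qed
    qed
    then show "spectral_le y z" by (simp add: spectral_le_def)
  qed
qed

text \<open>For m > a the steps over projections above \<open>spec x m\<close> lie in the interval,
  so these projections form a chain and the complement of \<open>spec x m\<close> is 0 or an atom.
  Hence the family is constant until it reaches 1, which happens at b.\<close>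

lemma chain_imp_step_atom:
  assumes x: "(x::'a) \<in> sa_part" and ax: "spectral_le (a *\<^sub>R 1) x" and ne: "x \<noteq> a *\<^sub>R 1"
    and chain: "chain_between (a *\<^sub>R 1) x"
  obtains b u where "a < b" "proj_atom u" "x = step a b (1 - u)"
proof -
  have xa: "adj x = x" using x by (simp add: sa_iff)
  note P = spec_projection[OF xa]
  have comparable: "loewner q r \<or> loewner r q"
    if m: "a < m" and q: "q \<in> projections" "loewner (spec x m) q"
      and r: "r \<in> projections" "loewner (spec x m) r" for m q r
  proof -
    have in_interval: "spectral_le (a *\<^sub>R 1) (step a m q) \<and> spectral_le (step a m q) x"
      if "q \<in> projections" "loewner (spec x m) q" for q
    proof -
      have "loewner (spec x l) q" if "l < m" for l
        using spec_mono[OF xa, of l m] \<open>loewner (spec x m) q\<close> that loewner_trans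
          by (meson less_imp_le)
      then show ?thesis using m that(1) step_le_iff[OF that(1) _ x ax] scalar_le_step[OF that(1)] by simp
    qed
    have "spectral_le (step a m q) (step a m r) \<or> spectral_le (step a m r) (step a m q)"
      using chain in_interval[OF q] in_interval[OF r] step_sa q r unfolding chain_between_def by blast
    then show ?thesis
    proof
      assume "spectral_le (step a m q) (step a m r)"
      then have "loewner (spec (step a m r) a) (spec (step a m q) a)" by (simp add: spectral_le_def)
      then show ?thesis using m q r by (simp add: spec_step)
    next
      assume "spectral_le (step a m r) (step a m q)"
      then have "loewner (spec (step a m q) a) (spec (step a m r) a)" by (simp add: spectral_le_def)
      then show ?thesis using m q r by (simp add: spec_step)
    qed
  qed
  have atom: "proj_atom (1 - spec x m)" if m: "a < m" and n1: "spec x m \<noteq> 1" for m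
    unfolding proj_atom_def
  proof (intro conjI ballI impI projection_compl P)
    show "1 - spec x m \<noteq> 0" using n1 by simp
    fix r assume r: "r \<in> projections" "loewner r (1 - spec x m)"
    have rE: "r * spec x m = 0" "spec x m * r = 0"
      using r loewner_projection_iff[OF r(1) projection_compl[OF P]]
        loewner_projection_iff'[OF r(1) projection_compl[OF P]] by (auto simp: algebra_simps)
    have rr: "r * r = r" and EE: "spec x m * spec x m = spec x m" using r P projectionsD by blast+
    have q: "spec x m + r \<in> projections"
      using r(1) P[of m] by (simp add: projections_def adj_simps algebra_simps rE)
    have r': "1 - r \<in> projections" using r projection_compl by blast
    have "loewner (spec x m) (spec x m + r)" using r by (simp add: loewner_iff_cpos cpos_projection)
    moreover have "loewner (spec x m) (1 - r)" using r(2) by (simp add: loewner_compl_swap[of r])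
    \<comment> \<open>These two projections above \<open>spec x m\<close> would be incomparable if r
      were neither 0 nor the whole complement.\<close>
    ultimately have "loewner (spec x m + r) (1 - r) \<or> loewner (1 - r) (spec x m + r)"
      using comparable[OF m q _ r'] by blast
    then show "r = 0 \<or> r = 1 - spec x m"
    proof
      assume "loewner (spec x m + r) (1 - r)"
      then have "(spec x m + r) * (1 - r) = spec x m + r" using loewner_projection_iff q r' by blast
      then have "r = 0" by (simp add: algebra_simps rE rr)
      then show ?thesis by simp
    next
      assume "loewner (1 - r) (spec x m + r)"
      then have "(1 - r) * (spec x m + r) = 1 - r" using loewner_projection_iff q r' by blast
      then have "spec x m = 1 - r" by (simp add: algebra_simps rE rr)
      then show ?thesis by simp
    qed
  qed
  have same: "spec x m = spec x n" if "a < m" "m \<le> n" "spec x n \<noteq> 1" for m n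
  proof -
    have m1: "spec x m \<noteq> 1" using that spec_eq_1_mono[OF x] by blast
    have "loewner (1 - spec x n) (1 - spec x m)" using spec_mono[OF xa that(2)]
      by (simp add: loewner_compl_iff)
    then have "1 - spec x n = 0 \<or> 1 - spec x n = 1 - spec x m"
      using atom[OF that(1) m1] projection_compl[OF P] by (auto simp: proj_atom_def)
    then show ?thesis using that by auto
  qed
  define S where "S = {m. a < m \<and> spec x m \<noteq> 1}"
  have "S \<noteq> {}"
  proof
    assume "S = {}"
    then have "spec x m = 1" if "a < m" for m using that by (auto simp: S_def)
    moreover have "spec x a = 1" by (rule spec_eq_1_right[OF x]) fact
    ultimately have "spec x l = (if l < a then 0 else 1)" for l
      using ax by (cases l a rule: linorder_cases) (auto simp: scalar_spectral_le_iff[OF x])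
    then have "spec x = spec (a *\<^sub>R 1)" by (auto simp: spec_scalar)
    then show False using spec_inj[OF xa, of "a *\<^sub>R 1"] ne by (simp add: adj_scaleR)
  qed
  then obtain m0 where m0: "a < m0" "spec x m0 \<noteq> 1" by (auto simp: S_def)
  have "bdd_above S"
    using spec_eq_1[OF xa] by (intro bdd_aboveI[of _ "norm x"]) (auto simp: S_def not_less[symmetric])
  define b where "b = Sup S"
  have "m0 \<le> b" unfolding b_def
    by (rule cSup_upper[OF _ \<open>bdd_above S\<close>]) (use m0 in \<open>simp add: S_def\<close>)
  have ab: "a < b" using m0 \<open>m0 \<le> b\<close> by simp
  have "x = step a b (1 - (1 - spec x m0))"
  proof (rule spec_eq_stepI[OF x _ ab])
    show "1 - (1 - spec x m0) \<in> projections" using P by simp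
    show "spec x l = 0" if "l < a" for l using ax that by (simp add: scalar_spectral_le_iff[OF x])
    show "spec x l = 1" if "b < l" for l
    proof (rule ccontr)
      assume "spec x l \<noteq> 1"
      then have "l \<in> S" using ab that by (simp add: S_def)
      then show False using cSup_upper[OF _ \<open>bdd_above S\<close>] that by (force simp: b_def)
    qed
    show "spec x l = 1 - (1 - spec x m0)" if l: "a < l" "l < b" for l
    proof -
      obtain n where n: "n \<in> S" "l < n" using less_cSupE[of l S] \<open>S \<noteq> {}\<close> l
        by (auto simp: b_def)
      have l1: "spec x l \<noteq> 1" using n spec_eq_1_mono[OF x, of l n] by (auto simp: S_def)
      have "spec x l = spec x m0"
      proof (cases "l \<le> m0")
        case True then show ?thesis by (intro same l m0)
      next
        case False then show ?thesis using same[of m0 l] l1 m0(1) by simp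
      qed
      then show ?thesis by simp
    qed
  qed
  then show thesis using that ab atom[OF m0] by blast
qed

end

context type_I_factor
begin

text \<open>Every spectral projection is central, hence 0 or 1, and the family has a single
  jump.\<close>

lemma neutral_imp_scalar:
  assumes x: "(x::'a) \<in> sa_part" and neu: "neutral x" shows "\<exists>c. x = c *\<^sub>R 1"
proof -
  have xa: "adj x = x" using x by (simp add: sa_iff)
  note P = spec_projection[OF xa]
  have dich: "spec x l = 0 \<or> spec x l = 1" for l
    by (rule central_projection[OF P central_of_commuting_projections[OF P]])
      (rule spec_commutes_of_neutral[OF x neu])
  define S where "S = {l. spec x l = 1}"
  have "norm x + 1 \<in> S" using spec_eq_1[OF xa, of "norm x + 1"] by (simp add: S_def)
  then have Sne: "S \<noteq> {}" by blast
  have bdd: "bdd_below S"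
    using spec_eq_0[OF xa] by (intro bdd_belowI[of _ "- norm x"]) (auto simp: S_def not_less[symmetric])
  define c where "c = Inf S"
  have up: "spec x l = 1" if lc: "c < l" for l
  proof -
    obtain s where "s \<in> S" "s < l" using lc cInf_less_iff[OF Sne bdd, of l] unfolding c_def by blast
    then show ?thesis using spec_eq_1_mono[OF x, of s l] by (simp add: S_def)
  qed
  have "spec x c = 1" by (rule spec_eq_1_right[OF x up])
  moreover have "spec x l = 0" if "l < c" for l
  proof -
    have "l \<notin> S" using that cInf_lower[OF _ bdd] by (force simp: c_def)
    then show ?thesis using dich by (auto simp: S_def)
  qed
  ultimately have "spec x l = (if l < c then 0 else 1)" for l
    using up by (cases l c rule: linorder_cases) auto
  then have "spec x = spec (c *\<^sub>R 1)" by (auto simp: spec_scalar)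
  then show ?thesis using spec_inj[OF xa, of "c *\<^sub>R 1"] by (auto simp: adj_scaleR)
qed

end

section \<open>Spectral order isomorphisms\<close>

lemma spectral_order_iso_inv:
  assumes "spectral_order_iso \<phi>" shows "spectral_order_iso (inv_into sa_part \<phi>)"
proof -
  have b: "bij_betw \<phi> sa_part sa_part"
    and le: "\<And>x y. x \<in> sa_part \<Longrightarrow> y \<in> sa_part \<Longrightarrow> spectral_le x y \<longleftrightarrow> spectral_le (\<phi> x) (\<phi> y)"
    using assms by (auto simp: spectral_order_iso_def)
  let ?g = "inv_into sa_part \<phi>"
  have "?g x \<in> sa_part" "\<phi> (?g x) = x" if "x \<in> sa_part" for x
    using b that by (metis bij_betw_imp_surj_on inv_into_into, metis bij_betw_inv_into_right)
  then show ?thesis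
    unfolding spectral_order_iso_def using bij_betw_inv_into[OF b] le by metis
qed

lemma spectral_order_iso_neutral:
  fixes \<phi> :: "'a::cstar_algebra \<Rightarrow> 'b::cstar_algebra"
  assumes "spectral_order_iso \<phi>" "x \<in> sa_part" "neutral x" shows "neutral (\<phi> x)"
proof -
  have im: "(sa_part :: 'b set) = \<phi> ` sa_part"
    using assms(1) by (auto simp: spectral_order_iso_def bij_betw_def)
  have le: "spectral_le (\<phi> x) (\<phi> y) \<longleftrightarrow> spectral_le x y" if "x \<in> sa_part" "y \<in> sa_part" for x y
    using assms(1) that by (auto simp: spectral_order_iso_def)
  have "neutral (\<phi> x) \<longleftrightarrow> neutral x"
    unfolding neutral_def im ball_simps(9)
    by (intro ball_cong refl) (simp add: le assms(2) cong: ball_cong)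
  then show ?thesis using assms(3) by simp
qed

lemma spectral_order_iso_chain:
  fixes \<phi> :: "'a::cstar_algebra \<Rightarrow> 'b::cstar_algebra"
  assumes "spectral_order_iso \<phi>" "a \<in> sa_part" "x \<in> sa_part" "chain_between a x"
  shows "chain_between (\<phi> a) (\<phi> x)"
proof -
  have im: "(sa_part :: 'b set) = \<phi> ` sa_part"
    using assms(1) by (auto simp: spectral_order_iso_def bij_betw_def)
  have le: "spectral_le (\<phi> x) (\<phi> y) \<longleftrightarrow> spectral_le x y" if "x \<in> sa_part" "y \<in> sa_part" for x y
    using assms(1) that by (auto simp: spectral_order_iso_def)
  have "chain_between (\<phi> a) (\<phi> x) \<longleftrightarrow> chain_between a x"
    unfolding chain_between_def im ball_simps(9)
    by (intro ball_cong refl) (simp add: le assms(2,3))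
  then show ?thesis using assms(4) by simp
qed

context aw_star_algebra
begin

text \<open>For p \<noteq> 1 the upper value b is attained, so the dominating scalars detect it.
  This recovers the second end point of an image step.\<close>

lemma step_le_scalar_iff:
  assumes p: "(p::'a) \<in> projections" "p \<noteq> 1" and ab: "a < b"
  shows "spectral_le (step a b p) (c *\<^sub>R 1) \<longleftrightarrow> b \<le> c"
proof -
  have "\<exists>l\<ge>c. spec (step a b p) l \<noteq> 1" if "c < b"
    using that ab p by (intro exI[of _ "max a c"]) (simp add: spec_step)
  then show ?thesis
    using step_le_scalar[OF p(1) less_imp_le[OF ab]] spectral_le_scalar_iff[OF step_sa[OF p(1)]]
    by (meson not_le)
qed

lemma step_le_step_iff:
  assumes p: "(p::'a) \<in> projections" and q: "q \<in> projections" and ab: "a < b"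
  shows "spectral_le (step a b p) (step a b q) \<longleftrightarrow> loewner q p"
proof -
  have "spectral_le (step a b p) (step a b q) \<longleftrightarrow> (\<forall>l<b. loewner (spec (step a b q) l) p)"
    using p q ab by (intro step_le_iff scalar_le_step step_sa) auto
  also have "\<dots> \<longleftrightarrow> loewner q p"
    using ab zero_loewner_projection[OF p] by (auto simp: spec_step q)
  finally show ?thesis .
qed

lemma step_inject:
  assumes "(p::'a) \<in> projections" "q \<in> projections" "a < b" "step a b p = step a b q"
  shows "p = q"
proof -
  have "spec (step a b p) a = spec (step a b q) a" using assms by simp
  then show ?thesis using assms(1-3) by (simp add: spec_step)
qed

text \<open>At \<open>a'\<close>, which lies in both intervals, the inequality of the families reads
  u \<le> w.\<close>

lemma overlapping_atom_steps:
  assumes u: "proj_atom (u::'a)" and w: "proj_atom w" and ab: "a \<le> a'" "a' < b" "b \<le> b'"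
    and le: "spectral_le (step a b (1 - u)) (step a' b' (1 - w))"
  shows "u = w"
proof -
  have up: "1 - u \<in> projections" "1 - w \<in> projections" using u w proj_atom_projection projection_compl by blast+
  have "loewner (spec (step a' b' (1 - w)) a') (spec (step a b (1 - u)) a')"
    using le by (simp add: spectral_le_def)
  then have "loewner u w" using ab up by (simp add: spec_step loewner_compl_iff)
  then show ?thesis using u w by (auto simp: proj_atom_def)
qed

end

section \<open>Transport of scalars, atoms and projections by the isomorphism\<close>

locale spectral_iso = M: type_I_factor T1 + N: type_I_factor T2
  for T1 :: "'a::cstar_algebra itself" and T2 :: "'b::cstar_algebra itself" +
  fixes \<phi> :: "'a \<Rightarrow> 'b"
  assumes iso: "spectral_order_iso \<phi>"
begin

lemma phi_sa: "x \<in> sa_part \<Longrightarrow> \<phi> x \<in> sa_part"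
  using iso by (auto simp: spectral_order_iso_def bij_betw_def)

lemma phi_le: "x \<in> sa_part \<Longrightarrow> y \<in> sa_part \<Longrightarrow> spectral_le (\<phi> x) (\<phi> y) \<longleftrightarrow> spectral_le x y"
  using iso by (auto simp: spectral_order_iso_def)

lemma phi_inj: "x \<in> sa_part \<Longrightarrow> y \<in> sa_part \<Longrightarrow> \<phi> x = \<phi> y \<Longrightarrow> x = y"
  using iso by (auto simp: spectral_order_iso_def bij_betw_def inj_on_def)

definition psi :: "'b \<Rightarrow> 'a" where "psi = inv_into sa_part \<phi>"

lemma phi_psi: "y \<in> sa_part \<Longrightarrow> \<phi> (psi y) = y"
  and psi_phi: "x \<in> sa_part \<Longrightarrow> psi (\<phi> x) = x"
  using iso by (auto simp: spectral_order_iso_def psi_def bij_betw_def f_inv_into_f)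

text \<open>Through this instance each existence result about \<phi> yields the matching
  surjectivity result.\<close>

lemma inverse: "spectral_iso T2 T1 psi"
  unfolding psi_def by unfold_locales (rule spectral_order_iso_inv[OF iso])

lemma phi_scalar: "\<exists>d. \<phi> (c *\<^sub>R 1) = d *\<^sub>R 1"
  by (intro N.neutral_imp_scalar phi_sa scalar_sa spectral_order_iso_neutral[OF iso] M.neutral_scalar)

definition scal :: "real \<Rightarrow> real" where "scal c = (SOME d. \<phi> (c *\<^sub>R 1) = d *\<^sub>R 1)"

lemma phi_scal: "\<phi> (c *\<^sub>R 1) = scal c *\<^sub>R 1"
  unfolding scal_def by (rule someI_ex[OF phi_scalar])

lemma scal_le_iff: "scal c \<le> scal d \<longleftrightarrow> c \<le> d"
  using phi_le[OF scalar_sa scalar_sa, of c d]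
  by (simp add: phi_scal N.scalar_le_scalar_iff M.scalar_le_scalar_iff)

lemma scal_strict_mono: "strict_mono scal"
  by (rule strict_monoI) (meson scal_le_iff not_le)

lemma scal_less_iff: "scal c < scal d \<longleftrightarrow> c < d"
  by (meson scal_le_iff not_le)

lemma scal_surj: obtains c where "d = scal c"
proof -
  obtain c where c: "psi (d *\<^sub>R 1) = c *\<^sub>R 1"
    using spectral_iso.phi_scalar[OF inverse] by blast
  have "scal c *\<^sub>R (1::'b) = d *\<^sub>R 1" using phi_psi[OF scalar_sa, of d]
    by (simp add: c phi_scal)
  then have "d = scal c" by simp
  then show thesis by (rule that)
qed

lemma scal_bij: "bij scal"
  using scal_strict_mono scal_surj by (auto simp: bij_def strict_mono_imp_inj_on surj_def)

lemma psi_scal: "psi (scal c *\<^sub>R 1) = c *\<^sub>R 1"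
  using psi_phi[OF scalar_sa, of c] by (simp add: phi_scal)

lemma inverse_scal: "spectral_iso.scal psi (scal c) = c"
proof -
  have "spectral_iso.scal psi (scal c) *\<^sub>R (1::'a) = c *\<^sub>R 1"
    using spectral_iso.phi_scal[OF inverse, of "scal c"] by (simp add: psi_scal)
  then show ?thesis by simp
qed

lemma scalar_le_phi_iff: "x \<in> sa_part \<Longrightarrow> spectral_le (scal c *\<^sub>R 1) (\<phi> x) \<longleftrightarrow> spectral_le (c *\<^sub>R 1) x"
  and phi_le_scalar_iff: "x \<in> sa_part \<Longrightarrow> spectral_le (\<phi> x) (scal c *\<^sub>R 1) \<longleftrightarrow> spectral_le x (c *\<^sub>R 1)"
  using phi_le[OF scalar_sa, of x c] phi_le[OF _ scalar_sa, of x c] by (simp_all add: phi_scal)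

text \<open>The chain property survives \<phi>, so the image is a step over a coatom with lower
  value \<open>scal a\<close>. Its upper value is found by testing which scalars dominate.\<close>

lemma phi_atom_step:
  assumes u: "proj_atom (u::'a)" and ab: "a < b"
  shows "\<exists>w. proj_atom w \<and> \<phi> (step a b (1 - u)) = step (scal a) (scal b) (1 - w)"
proof -
  have up: "1 - u \<in> projections" "1 - u \<noteq> 1" using u projection_compl
    by (auto simp: proj_atom_def)
  let ?x = "step a b (1 - u)"
  have x: "?x \<in> sa_part" using step_sa up by blast
  have ax: "spectral_le (a *\<^sub>R 1) ?x" using M.scalar_le_step up ab by simp
  have "?x \<noteq> a *\<^sub>R 1"
  proof
    assume "?x = a *\<^sub>R 1"
    then have "spec ?x a = spec (a *\<^sub>R 1) a" by simp
    then show False using up ab by (simp add: M.spec_step M.spec_scalar)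
  qed
  then have "\<phi> ?x \<noteq> scal a *\<^sub>R 1" using phi_inj[OF x scalar_sa]
    by (auto simp flip: phi_scal)
  moreover have "chain_between (scal a *\<^sub>R 1) (\<phi> ?x)"
    using spectral_order_iso_chain[OF iso scalar_sa x M.step_atom_chain[OF u ab]] by (simp add: phi_scal)
  moreover have "spectral_le (scal a *\<^sub>R 1) (\<phi> ?x)" using ax
    by (simp add: scalar_le_phi_iff x)
  ultimately obtain b' w where w: "scal a < b'" "proj_atom w" "\<phi> ?x = step (scal a) b' (1 - w)"
    using N.chain_imp_step_atom[OF phi_sa[OF x]] by metis
  have wp: "1 - w \<in> projections" "1 - w \<noteq> 1" using w projection_compl
    by (auto simp: proj_atom_def)
  obtain b0 where b0: "b' = scal b0" using scal_surj by blast
  have "b \<le> c \<longleftrightarrow> b0 \<le> c" for c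
    using phi_le_scalar_iff[OF x, of c] N.step_le_scalar_iff[OF wp w(1), of "scal c"]
      M.step_le_scalar_iff[OF up ab, of c] by (simp add: w(3) b0 scal_le_iff)
  then have "b0 = b" by (meson order_antisym order_refl)
  then show ?thesis using w b0 by blast
qed

text \<open>A relation rather than a function, so that it can be entered from u as well as from w
  through the inverse.\<close>

definition atom_image :: "'a \<Rightarrow> 'b \<Rightarrow> bool" where
  "atom_image u w \<longleftrightarrow> proj_atom u \<and> proj_atom w \<and>
     (\<forall>a b. a < b \<longrightarrow> \<phi> (step a b (1 - u)) = step (scal a) (scal b) (1 - w))"

lemma atom_image_exists:
  assumes u: "proj_atom u" shows "\<exists>w. atom_image u w"
proof -
  obtain W where W: "\<And>a b. a < b \<Longrightarrow> proj_atom (W a b)"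
    "\<And>a b. a < b \<Longrightarrow> \<phi> (step a b (1 - u)) = step (scal a) (scal b) (1 - W a b)"
    using phi_atom_step[OF u] by metis
  have up: "1 - u \<in> projections" using u proj_atom_projection projection_compl by blast
  have eq: "W a b = W a' b'" if h: "a \<le> a'" "a' < b" "b \<le> b'" for a b a' b'
  proof (rule N.overlapping_atom_steps)
    have "spectral_le (step a b (1 - u)) (step a' b' (1 - u))"
      using h up M.zero_loewner_projection[OF up] M.projection_loewner_one[OF up] M.zero_loewner_projection[OF projection_1]
      by (auto simp: spectral_le_def M.spec_step)
    then show "spectral_le (step (scal a) (scal b) (1 - W a b)) (step (scal a') (scal b') (1 - W a' b'))"
      using h phi_le[OF step_sa[OF up] step_sa[OF up], of a b a' b'] by (simp add: W(2))
  qed (use h W in \<open>auto simp: scal_le_iff scal_less_iff\<close>)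
  have const: "W a b = W 0 1" if "a < b" for a b
  proof -
    \<comment> \<open>Each move changes one end point and keeps an overlap: lower the left end,
      raise the right end, then bring them to 1 and 0.\<close>
    have "W a b = W (min a 0) b" using that eq[of "min a 0" a b b] by simp
    also have "\<dots> = W (min a 0) (max b 1)" using that by (intro eq) auto
    also have "\<dots> = W (min a 0) 1" by (intro eq[symmetric]) auto
    also have "\<dots> = W 0 1" by (intro eq) auto
    finally show ?thesis .
  qed
  have "\<phi> (step a b (1 - u)) = step (scal a) (scal b) (1 - W 0 1)" if "a < b" for a b
    using W(2)[OF that] by (simp only: const[OF that])
  then show ?thesis using W(1)[of 0 1] u unfolding atom_image_def by auto
qed

lemma atom_image_surj:
  assumes w: "proj_atom w" shows "\<exists>u. atom_image u w"
proof -
  obtain u where "spectral_iso.atom_image psi w u" using spectral_iso.atom_image_exists[OF inverse w] by blast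
  then have u: "proj_atom u" and eq: "\<And>a b. a < b \<Longrightarrow> psi (step a b (1 - w)) =
      step (spectral_iso.scal psi a) (spectral_iso.scal psi b) (1 - u)"
    by (auto simp: spectral_iso.atom_image_def[OF inverse])
  have wp: "1 - w \<in> projections" using w proj_atom_projection projection_compl by blast
  have "\<phi> (step a b (1 - u)) = step (scal a) (scal b) (1 - w)" if "a < b" for a b
    using eq[of "scal a" "scal b"] that phi_psi[OF step_sa[OF wp], of "scal a" "scal b"]
    by (simp add: scal_less_iff inverse_scal)
  then show ?thesis using u w unfolding atom_image_def by blast
qed

text \<open>The lower value of the step is auxiliary: taken below both - norm x and b, it makes
  \<open>step_le_iff\<close> applicable on both sides of \<phi>.\<close>

lemma step_le_phi_iff:
  assumes p: "p \<in> projections" and q: "q \<in> projections"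
    and eq: "\<And>a b. a < b \<Longrightarrow> \<phi> (step a b p) = step (scal a) (scal b) q" and x: "x \<in> sa_part"
  shows "(\<forall>l<scal b. loewner (spec (\<phi> x) l) q) \<longleftrightarrow> (\<forall>l<b. loewner (spec x l) p)"
proof -
  define a where "a = min (- norm x) (b - 1)"
  have ab: "a < b" "a \<le> - norm x" by (auto simp: a_def)
  have ax: "spectral_le (a *\<^sub>R 1) x" using M.scalar_below[OF x ab(2)] .
  then have ay: "spectral_le (scal a *\<^sub>R 1) (\<phi> x)" by (simp add: scalar_le_phi_iff x)
  have ab': "scal a \<le> scal b" using ab by (simp add: scal_le_iff)
  show ?thesis
    using N.step_le_iff[OF q ab' phi_sa[OF x] ay] M.step_le_iff[OF p less_imp_le[OF ab(1)] x ax]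
      phi_le[OF step_sa[OF p] x, of a b] by (simp add: eq[OF ab(1)])
qed

lemma atom_image_le_iff:
  assumes uw: "atom_image u w" and x: "x \<in> sa_part"
  shows "(\<forall>l<scal b. loewner (spec (\<phi> x) l) (1 - w)) \<longleftrightarrow> (\<forall>l<b. loewner (spec x l) (1 - u))"
  by (rule step_le_phi_iff[OF _ _ _ x])
    (use uw in \<open>auto simp: atom_image_def intro: proj_atom_projection projection_compl\<close>)

text \<open>At each point of the open interval the coatoms above the spectral projection of y
  correspond under \<open>atom_image\<close> to those above p. By
  \<open>projection_le_by_atoms\<close> the family of y is constant there, so y is a step.\<close>

lemma phi_step_aux:
  assumes p: "p \<in> projections" and ab: "a < b"
  shows "\<exists>q\<in>projections. \<phi> (step a b p) = step (scal a) (scal b) q \<and>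
    (\<forall>u w. atom_image u w \<longrightarrow> (loewner q (1 - w) \<longleftrightarrow> loewner p (1 - u)))"
proof -
  let ?x = "step a b p"
  define y where "y = \<phi> ?x"
  have x: "?x \<in> sa_part" using step_sa p by blast
  then have y: "y \<in> sa_part" using phi_sa by (simp add: y_def)
  then have ya: "adj y = y" by (simp add: sa_iff)
  note P = N.spec_projection[OF ya]
  have ab': "scal a < scal b" using ab by (simp add: scal_less_iff)
  have lower: "spec y l = 0" if "l < scal a" for l
    using that scalar_le_phi_iff[OF x, of a] M.scalar_le_step[OF p order_refl less_imp_le[OF ab]]
    by (simp add: N.scalar_spectral_le_iff[OF y, unfolded y_def] y_def)
  have upper: "spec y l = 1" if "scal b \<le> l" for l
    using that phi_le_scalar_iff[OF x, of b] M.step_le_scalar[OF p less_imp_le[OF ab] order_refl]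
    by (simp add: N.spectral_le_scalar_iff[OF y, unfolded y_def] y_def)
  have below: "loewner (spec y l) (spec y k)" if k: "scal a < k" "k < scal b" and l: "l < scal b" for k l
  proof (rule N.projection_le_by_atoms[OF P P])
    fix w assume w: "proj_atom w" "loewner (spec y k) (1 - w)"
    obtain u where uw: "atom_image u w" using atom_image_surj[OF w(1)] by blast
    then have up: "1 - u \<in> projections"
      by (auto simp: atom_image_def intro: proj_atom_projection projection_compl)
    obtain c where c: "k = scal c" using scal_surj by blast
    have ac: "a < c" "c < b" using k by (simp_all add: c scal_less_iff)
    have "\<forall>l<scal c. loewner (spec y l) (1 - w)"
      using N.loewner_trans[OF N.spec_mono[OF ya] w(2)] by (simp add: c)
    then have "\<forall>l<c. loewner (spec ?x l) (1 - u)" using atom_image_le_iff[OF uw x]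
      by (simp add: y_def)
    then have "loewner p (1 - u)" using ac ab by (auto simp: M.spec_step p)
    then have "\<forall>l<b. loewner (spec ?x l) (1 - u)"
      using ab M.zero_loewner_projection[OF up] by (simp add: M.spec_step p)
    then show "loewner (spec y l) (1 - w)" using atom_image_le_iff[OF uw x, of b] l unfolding y_def by blast
  qed
  \<comment> \<open>An arbitrary interior point at which q is read off.\<close>
  define k where "k = (scal a + scal b) / 2"
  have k: "scal a < k" "k < scal b" using ab' by (auto simp: k_def)
  define q where "q = spec y k"
  have q: "q \<in> projections" using P by (simp add: q_def)
  have yq: "y = step (scal a) (scal b) q"
  proof (rule N.spec_eq_stepI[OF y q ab' lower])
    show "spec y l = q" if "scal a < l" "l < scal b" for l
      unfolding q_def using below[OF k that(2)] below[OF that k(2)] N.loewner_antisym by blast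
  qed (use upper in auto)
  have "loewner q (1 - w) \<longleftrightarrow> loewner p (1 - u)" if uw: "atom_image u w" for u w
  proof -
    have up: "1 - u \<in> projections" "1 - w \<in> projections"
      using uw by (auto simp: atom_image_def intro: proj_atom_projection projection_compl)
    have "loewner q (1 - w) \<longleftrightarrow> (\<forall>l<scal b. loewner (spec y l) (1 - w))"
      unfolding yq using ab' N.zero_loewner_projection[OF up(2)] by (auto simp: N.spec_step q)
    also have "\<dots> \<longleftrightarrow> (\<forall>l<b. loewner (spec ?x l) (1 - u))"
      unfolding y_def by (rule atom_image_le_iff[OF uw x])
    also have "\<dots> \<longleftrightarrow> loewner p (1 - u)"
      using ab M.zero_loewner_projection[OF up(1)] by (auto simp: M.spec_step p)
    finally show ?thesis .
  qed
  then show ?thesis using q yq by (auto simp: y_def)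
qed

text \<open>The coatoms above the projection of the image step depend on p alone, so the projection
  does not vary with the end points.\<close>

lemma phi_step:
  assumes p: "p \<in> projections"
  shows "\<exists>q\<in>projections. \<forall>a b. a < b \<longrightarrow> \<phi> (step a b p) = step (scal a) (scal b) q"
proof -
  obtain Q where Q: "\<And>a b. a < b \<Longrightarrow> Q a b \<in> projections"
    "\<And>a b. a < b \<Longrightarrow> \<phi> (step a b p) = step (scal a) (scal b) (Q a b)"
    "\<And>a b u w. a < b \<Longrightarrow> atom_image u w \<Longrightarrow> loewner (Q a b) (1 - w) \<longleftrightarrow> loewner p (1 - u)"
    using phi_step_aux[OF p] by metis
  have le: "loewner (Q a b) (Q a' b')" if "a < b" "a' < b'" for a b a' b'
  proof (rule N.projection_le_by_atoms[OF Q(1)[OF that(1)] Q(1)[OF that(2)]])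
    fix w assume w: "proj_atom w" "loewner (Q a' b') (1 - w)"
    obtain u where uw: "atom_image u w" using atom_image_surj[OF w(1)] by blast
    show "loewner (Q a b) (1 - w)" using w(2) Q(3)[OF that(1) uw] Q(3)[OF that(2) uw] by simp
  qed
  have const: "Q a b = Q 0 1" if "a < b" for a b
    using that le by (intro N.loewner_antisym) auto
  have "\<phi> (step a b p) = step (scal a) (scal b) (Q 0 1)" if "a < b" for a b
    using Q(2)[OF that] by (simp only: const[OF that])
  then show ?thesis using Q(1)[of 0 1] by auto
qed

definition tau :: "'a \<Rightarrow> 'b" where
  "tau p = (SOME q. q \<in> projections \<and> (\<forall>a b. a < b \<longrightarrow> \<phi> (step a b p) = step (scal a) (scal b) q))"

lemma
  assumes "p \<in> projections"
  shows tau_projection: "tau p \<in> projections"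
    and phi_step_tau: "a < b \<Longrightarrow> \<phi> (step a b p) = step (scal a) (scal b) (tau p)"
proof -
  have "tau p \<in> projections \<and> (\<forall>a b. a < b \<longrightarrow> \<phi> (step a b p) = step (scal a) (scal b) (tau p))"
    unfolding tau_def by (rule someI_ex) (use phi_step[OF assms] in blast)
  then show "tau p \<in> projections" "a < b \<Longrightarrow> \<phi> (step a b p) = step (scal a) (scal b) (tau p)" by auto
qed

text \<open>Passing to steps reverses the order of projections on both sides of \<phi>, and the
  reversals cancel.\<close>

lemma tau_le_iff:
  assumes "p \<in> projections" "q \<in> projections" shows "loewner (tau p) (tau q) \<longleftrightarrow> loewner p q"
  using phi_le[OF step_sa[OF assms(2)] step_sa[OF assms(1)], of 0 1 0 1] assms
    N.step_le_step_iff[OF tau_projection tau_projection, of q p "scal 0" "scal 1"]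
  by (simp add: phi_step_tau M.step_le_step_iff scal_less_iff)

lemma tau_surj:
  assumes q: "q \<in> projections" shows "\<exists>p\<in>projections. tau p = q"
proof -
  obtain p where p: "p \<in> projections" "\<And>a b. a < b \<Longrightarrow>
      psi (step a b q) = step (spectral_iso.scal psi a) (spectral_iso.scal psi b) p"
    using spectral_iso.phi_step[OF inverse q] by blast
  have s: "scal 0 < scal 1" by (simp add: scal_less_iff)
  have "psi (step (scal 0) (scal 1) q) = step 0 1 p" using p(2)[OF s] by (simp add: inverse_scal)
  then have "step (scal 0) (scal 1) (tau p) = step (scal 0) (scal 1) q"
    using phi_psi[OF step_sa[OF q], of "scal 0" "scal 1"] phi_step_tau[OF p(1), of 0 1] by simp
  then show ?thesis using N.step_inject[OF tau_projection[OF p(1)] q s] p(1) by blast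
qed

lemma projection_iso_tau: "projection_iso tau"
  unfolding projection_iso_def bij_betw_def inj_on_def
proof (intro conjI ballI impI)
  show "p = q" if "p \<in> projections" "q \<in> projections" "tau p = tau q" for p q
    using that tau_le_iff[of p q] tau_le_iff[of q p] M.loewner_antisym by simp
  show "tau ` projections = projections"
    using tau_projection tau_surj by (auto simp: image_iff)
qed (simp add: tau_le_iff)

text \<open>\<open>step_le_phi_iff\<close> tests only strictly below its bound, so each inequality
  is proved at arguments beyond l and then pushed down by right continuity, with target projections
  written as values of \<open>tau\<close>.\<close>

lemma spec_phi:
  assumes x: "x \<in> sa_part" shows "spec (\<phi> x) (scal l) = tau (spec x l)"
proof (rule N.loewner_antisym)
  have xa: "adj x = x" and ya: "adj (\<phi> x) = \<phi> x" using x phi_sa by (auto simp: sa_iff)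
  note P = M.spec_projection[OF xa] and Q = N.spec_projection[OF ya]
  note key = step_le_phi_iff[OF _ tau_projection phi_step_tau x]
  obtain q where q: "q \<in> projections" "tau q = spec (\<phi> x) (scal l)" using tau_surj[OF Q] by blast
  have "loewner q (spec x l)"
  proof (rule M.spec_rightI[OF xa q(1)])
    fix m assume m: "l < m"
    have "\<forall>k<m. loewner (spec x k) (spec x m)" using M.spec_mono[OF xa] by simp
    then have "loewner (spec (\<phi> x) (scal l)) (tau (spec x m))"
      using key[OF P P P, of m m] m by (simp add: scal_less_iff)
    then show "loewner q (spec x m)" using tau_le_iff[OF q(1) P] by (simp add: q(2))
  qed
  then show "loewner (spec (\<phi> x) (scal l)) (tau (spec x l))" using tau_le_iff[OF q(1) P]
    by (simp add: q(2))
  show "loewner (tau (spec x l)) (spec (\<phi> x) (scal l))"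
  proof (rule N.spec_rightI[OF ya tau_projection[OF P]])
    fix n assume n: "scal l < n"
    obtain m where m: "n = scal m" using scal_surj by blast
    obtain r where r: "r \<in> projections" "tau r = spec (\<phi> x) n" using tau_surj[OF Q] by blast
    have "\<forall>k<scal m. loewner (spec (\<phi> x) k) (tau r)" using N.spec_mono[OF ya]
      by (simp add: r m)
    then have "loewner (spec x l) r" using key[OF r(1) r(1) r(1), of m] n by (simp add: m scal_less_iff)
    then show "loewner (tau (spec x l)) (spec (\<phi> x) n)" using tau_le_iff[OF P r(1)]
      by (simp add: r(2))
  qed
qed

text \<open>\<open>spec_phi\<close> and \<open>spec_fcalc\<close> shift the spectral argument by the
  same \<open>scal\<close>, so the shifts cancel; \<open>spec_inj\<close> settles the description in
  \<open>Theta\<close>.\<close>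

lemma phi_canonical:
  assumes x: "x \<in> sa_part" shows "\<phi> x = Theta tau (fcalc scal x)"
proof -
  have xa: "adj x = x" using x by (simp add: sa_iff)
  have *: "spec (\<phi> x) l = tau (spec (fcalc scal x) l)" for l
  proof -
    obtain k where "l = scal k" using scal_surj by blast
    then show ?thesis
      using spec_phi[OF x, of k] M.spec_fcalc(2)[OF xa scal_strict_mono scal_bij, of k] by simp
  qed
  show ?thesis unfolding Theta_def
  proof (rule the_equality[symmetric])
    show "\<phi> x \<in> sa_part \<and> (\<forall>l. spec (\<phi> x) l = tau (spec (fcalc scal x) l))" using * phi_sa x by blast
    fix y assume y: "y \<in> sa_part \<and> (\<forall>l. spec y l = tau (spec (fcalc scal x) l))"
    then have "spec y = spec (\<phi> x)" using * by auto
    then show "y = \<phi> x" using N.spec_inj y phi_sa[OF x] by (simp add: sa_iff)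
  qed
qed

end

theorem theorem4p7:
  fixes \<phi> :: "'a::cstar_algebra \<Rightarrow> 'b::cstar_algebra"
  assumes "AW_factor TYPE('a)" and "type_I TYPE('a)"
    and "AW_factor TYPE('b)" and "type_I TYPE('b)"
    and "spectral_order_iso \<phi>"
  shows "\<exists>(f::real \<Rightarrow> real) (\<tau>::'a \<Rightarrow> 'b).
           strict_mono f \<and> bij f \<and> projection_iso \<tau> \<and>
           (\<forall>x\<in>sa_part. \<phi> x = Theta \<tau> (fcalc f x))"
proof -
  interpret spectral_iso "TYPE('a)" "TYPE('b)" \<phi>
    by unfold_locales (use assms in \<open>auto simp: AW_factor_def\<close>)
  show ?thesis
    using scal_strict_mono scal_bij projection_iso_tau phi_canonical by blast
qed

end
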